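(* Let $G$ be a groupoid with finite unit space $G^0$, and let $C\in G^0/\!\sim$. Fix $x\in C$, let $G_x$ be the isotropy group at $x$, and for each $y\in C$ choose $k_y\in G$ with $d(k_y)=x$ and $c(k_y)=y$, with $k_x=x$. Then for every trace $\tau_C$ on $C^*(G_x)$ there is a trace $\tau_C'$ on $C^*(G)$ such that for $g\in G$ $$\tau_C'(i(g))=\begin{cases}\tau_C\big(u(k_{c(g)}^{-1}gk_{d(g)})\big)&\text{if }d(g)=c(g)\in C\\0&\text{otherwise.}\end{cases}$$ Every trace on $C^*(G)$ is a sum of traces of the form $\tau_C'$ (over classes $C\in G^0/\!\sim$).
   Context: A groupoid $G$ with unit space $G^0$ is a (discrete) small category with inverses, with domain and codomain maps $d,c:G\to G^0$ and product $gh$ defined when $d(g)=c(h)$; units are identified with identity morphisms. The equivalence relation $\sim$ on $G^0$ is: $x\sim y$ iff there is $g\in G$ with $d(g)=x$ and $c(g)=y$. $G_x=\{g\in G:d(g)=c(g)=x\}$. A unitary representation $U$ of $G$ in a $C^*$-algebra assigns to each $v\in G^0$ a projection $U_v$ and to each $g\in G$ a partial isometry $U_g$ with initial projection $U_{d(g)}$ and final projection $U_{c(g)}$, with $U_gU_h=U_{gh}$ if $d(g)=c(h)$ and $0$ otherwise. $C^*(G)$ is the full groupoid $C^*$-algebra and $i:G\to C^*(G)$ its canonical universal unitary representation; $u:G_x\to C^*(G_x)$ is the canonical unitary representation of the group $G_x$ in its full group $C^*$-algebra. A trace on a $C^*$-algebra is a positive linear functional $\tau$ with $\tau(ab)=\tau(ba)$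 (not necessarily normalised). *)

theory Defs
  imports "HOL-Analysis.Analysis" "HOL-Algebra.Module"
begin

section \<open>Groupoids\<close>

text \<open>
  A groupoid is given by its set of arrows; units are identified with identity arrows.
  The product \<^term>\<open>gmul G g h\<close> is meaningful only if \<^term>\<open>gdom G g = gcod G h\<close>.
\<close>

record 'g groupoid =
  arrows :: "'g set"
  gdom :: "'g \<Rightarrow> 'g"
  gcod :: "'g \<Rightarrow> 'g"
  gmul :: "'g \<Rightarrow> 'g \<Rightarrow> 'g"
  ginv :: "'g \<Rightarrow> 'g"

locale groupoid =
  fixes G :: "'g groupoid"
  assumes dom_closed: "g \<in> arrows G \<Longrightarrow> gdom G g \<in> arrows G"
    and cod_closed: "g \<in> arrows G \<Longrightarrow> gcod G g \<in> arrows G"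
    and dom_dom: "g \<in> arrows G \<Longrightarrow> gdom G (gdom G g) = gdom G g"
    and cod_dom: "g \<in> arrows G \<Longrightarrow> gcod G (gdom G g) = gdom G g"
    and dom_cod: "g \<in> arrows G \<Longrightarrow> gdom G (gcod G g) = gcod G g"
    and cod_cod: "g \<in> arrows G \<Longrightarrow> gcod G (gcod G g) = gcod G g"
    and mul_closed: "\<lbrakk>g \<in> arrows G; h \<in> arrows G; gdom G g = gcod G h\<rbrakk>
      \<Longrightarrow> gmul G g h \<in> arrows G"
    and dom_mul: "\<lbrakk>g \<in> arrows G; h \<in> arrows G; gdom G g = gcod G h\<rbrakk>
      \<Longrightarrow> gdom G (gmul G g h) = gdom G h"
    and cod_mul: "\<lbrakk>g \<in> arrows G; h \<in> arrows G; gdom G g = gcod G h\<rbrakk>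
      \<Longrightarrow> gcod G (gmul G g h) = gcod G g"
    and mul_assoc: "\<lbrakk>g \<in> arrows G; h \<in> arrows G; k \<in> arrows G;
        gdom G g = gcod G h; gdom G h = gcod G k\<rbrakk>
      \<Longrightarrow> gmul G (gmul G g h) k = gmul G g (gmul G h k)"
    and mul_dom: "g \<in> arrows G \<Longrightarrow> gmul G g (gdom G g) = g"
    and cod_mul_self: "g \<in> arrows G \<Longrightarrow> gmul G (gcod G g) g = g"
    and inv_closed: "g \<in> arrows G \<Longrightarrow> ginv G g \<in> arrows G"
    and dom_inv: "g \<in> arrows G \<Longrightarrow> gdom G (ginv G g) = gcod G g"
    and cod_inv: "g \<in> arrows G \<Longrightarrow> gcod G (ginv G g) = gdom G g"
    and inv_mul: "g \<in> arrows G \<Longrightarrow> gmul G (ginv G g) g = gdom G g"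
    and mul_inv: "g \<in> arrows G \<Longrightarrow> gmul G g (ginv G g) = gcod G g"

definition units :: "'g groupoid \<Rightarrow> 'g set" where
  "units G = {v \<in> arrows G. gdom G v = v}"

definition orbit_rel :: "'g groupoid \<Rightarrow> ('g \<times> 'g) set" where
  "orbit_rel G = {(x, y). x \<in> units G \<and> y \<in> units G \<and>
     (\<exists>g \<in> arrows G. gdom G g = x \<and> gcod G g = y)}"

definition isotropy_group :: "'g groupoid \<Rightarrow> 'g \<Rightarrow> 'g monoid" where
  "isotropy_group G x =
     \<lparr>carrier = {g \<in> arrows G. gdom G g = x \<and> gcod G g = x}, mult = gmul G, one = x\<rparr>"

definition group_groupoid :: "'g monoid \<Rightarrow> 'g groupoid" where
  "group_groupoid H =
     \<lparr>arrows = carrier H, gdom = (\<lambda>_. \<one>\<^bsub>H\<^esub>), gcod = (\<lambda>_. \<one>\<^bsub>H\<^esub>), gmul = mult H, ginv = m_inv H\<rparr>"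


section \<open>C*-algebras\<close>

text \<open>
  Algebras need not be unital: the field \<^const>\<open>one\<close> inherited from the ring record is never used
  in the notions below.
\<close>

record 'a star_alg = "(complex, 'a) module" +
  star :: "'a \<Rightarrow> 'a"

record 'a normed_star_alg = "'a star_alg" +
  cnorm :: "'a \<Rightarrow> real"

definition complex_ring :: "complex ring" where
  "complex_ring = \<lparr>carrier = UNIV, mult = (*), one = 1, zero = 0, add = (+)\<rparr>"

locale star_algebra =
  fixes A :: "('a, 'm) star_alg_scheme" (structure)
  assumes complex_module: "module complex_ring A"
    and mult_closed: "\<lbrakk>a \<in> carrier A; b \<in> carrier A\<rbrakk> \<Longrightarrow> a \<otimes> b \<in> carrier A"
    and mult_assoc: "\<lbrakk>a \<in> carrier A; b \<in> carrier A; c \<in> carrier A\<rbrakk>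
      \<Longrightarrow> (a \<otimes> b) \<otimes> c = a \<otimes> (b \<otimes> c)"
    and mult_distl: "\<lbrakk>a \<in> carrier A; b \<in> carrier A; c \<in> carrier A\<rbrakk>
      \<Longrightarrow> (a \<oplus> b) \<otimes> c = a \<otimes> c \<oplus> b \<otimes> c"
    and mult_distr: "\<lbrakk>a \<in> carrier A; b \<in> carrier A; c \<in> carrier A\<rbrakk>
      \<Longrightarrow> a \<otimes> (b \<oplus> c) = a \<otimes> b \<oplus> a \<otimes> c"
    and mult_smultl: "\<lbrakk>a \<in> carrier A; b \<in> carrier A\<rbrakk> \<Longrightarrow> (z \<odot> a) \<otimes> b = z \<odot> (a \<otimes> b)"
    and mult_smultr: "\<lbrakk>a \<in> carrier A; b \<in> carrier A\<rbrakk> \<Longrightarrow> a \<otimes> (z \<odot> b) = z \<odot> (a \<otimes> b)"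
    and star_closed: "a \<in> carrier A \<Longrightarrow> star A a \<in> carrier A"
    and star_add: "\<lbrakk>a \<in> carrier A; b \<in> carrier A\<rbrakk> \<Longrightarrow> star A (a \<oplus> b) = star A a \<oplus> star A b"
    and star_smult: "a \<in> carrier A \<Longrightarrow> star A (z \<odot> a) = cnj z \<odot> star A a"
    and star_mult: "\<lbrakk>a \<in> carrier A; b \<in> carrier A\<rbrakk> \<Longrightarrow> star A (a \<otimes> b) = star A b \<otimes> star A a"
    and star_star: "a \<in> carrier A \<Longrightarrow> star A (star A a) = a"

definition cstar_seminorm :: "('a, 'm) star_alg_scheme \<Rightarrow> ('a \<Rightarrow> real) \<Rightarrow> bool" where
  "cstar_seminorm A p \<longleftrightarrow>
     (\<forall>a\<in>carrier A. 0 \<le> p a) \<and>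
     (\<forall>a\<in>carrier A. \<forall>b\<in>carrier A. p (a \<oplus>\<^bsub>A\<^esub> b) \<le> p a + p b) \<and>
     (\<forall>a\<in>carrier A. \<forall>z. p (z \<odot>\<^bsub>A\<^esub> a) = cmod z * p a) \<and>
     (\<forall>a\<in>carrier A. \<forall>b\<in>carrier A. p (a \<otimes>\<^bsub>A\<^esub> b) \<le> p a * p b) \<and>
     (\<forall>a\<in>carrier A. p (star A a \<otimes>\<^bsub>A\<^esub> a) = (p a)\<^sup>2)"

definition cauchy_seqs :: "('a, 'm) star_alg_scheme \<Rightarrow> ('a \<Rightarrow> real) \<Rightarrow> (nat \<Rightarrow> 'a) set" where
  "cauchy_seqs A p = {s. (\<forall>n. s n \<in> carrier A) \<and>
     (\<forall>e>0. \<exists>N. \<forall>m\<ge>N. \<forall>n\<ge>N. p (s m \<ominus>\<^bsub>A\<^esub> s n) < e)}"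

locale cstar_algebra = star_algebra A for A :: "('a, 'm) normed_star_alg_scheme" (structure) +
  assumes cstar_norm: "cstar_seminorm A (cnorm A)"
    and norm_definite: "\<lbrakk>a \<in> carrier A; cnorm A a = 0\<rbrakk> \<Longrightarrow> a = \<zero>"
    and norm_complete: "s \<in> cauchy_seqs A (cnorm A)
      \<Longrightarrow> \<exists>a\<in>carrier A. (\<lambda>n. cnorm A (s n \<ominus> a)) \<longlonglongrightarrow> 0"

definition star_hom ::
  "('a, 'm) star_alg_scheme \<Rightarrow> ('b, 'n) star_alg_scheme \<Rightarrow> ('a \<Rightarrow> 'b) \<Rightarrow> bool" where
  "star_hom A B f \<longleftrightarrow>
     f \<in> carrier A \<rightarrow> carrier B \<and>
     (\<forall>a\<in>carrier A. \<forall>b\<in>carrier A. f (a \<oplus>\<^bsub>A\<^esub> b) = f a \<oplus>\<^bsub>B\<^esub> f b) \<and>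
     (\<forall>a\<in>carrier A. \<forall>z. f (z \<odot>\<^bsub>A\<^esub> a) = z \<odot>\<^bsub>B\<^esub> f a) \<and>
     (\<forall>a\<in>carrier A. \<forall>b\<in>carrier A. f (a \<otimes>\<^bsub>A\<^esub> b) = f a \<otimes>\<^bsub>B\<^esub> f b) \<and>
     (\<forall>a\<in>carrier A. f (star A a) = star B (f a))"

text \<open>Traces are not normalised; only their values on the carrier matter.\<close>

definition tracial :: "('a, 'm) star_alg_scheme \<Rightarrow> ('a \<Rightarrow> complex) \<Rightarrow> bool" where
  "tracial A \<tau> \<longleftrightarrow>
     (\<forall>a\<in>carrier A. \<forall>b\<in>carrier A. \<tau> (a \<oplus>\<^bsub>A\<^esub> b) = \<tau> a + \<tau> b) \<and>
     (\<forall>a\<in>carrier A. \<forall>z. \<tau> (z \<odot>\<^bsub>A\<^esub> a) = z * \<tau> a) \<and>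
     (\<forall>a\<in>carrier A. \<tau> (star A a \<otimes>\<^bsub>A\<^esub> a) \<in> \<real>\<^sub>\<ge>\<^sub>0) \<and>
     (\<forall>a\<in>carrier A. \<forall>b\<in>carrier A. \<tau> (a \<otimes>\<^bsub>A\<^esub> b) = \<tau> (b \<otimes>\<^bsub>A\<^esub> a))"

definition unitary_rep ::
  "'g groupoid \<Rightarrow> ('a, 'm) star_alg_scheme \<Rightarrow> ('g \<Rightarrow> 'a) \<Rightarrow> bool" where
  "unitary_rep G A U \<longleftrightarrow>
     (\<forall>g\<in>arrows G. U g \<in> carrier A) \<and>
     (\<forall>v\<in>units G. star A (U v) = U v \<and> U v \<otimes>\<^bsub>A\<^esub> U v = U v) \<and>
     (\<forall>g\<in>arrows G. star A (U g) \<otimes>\<^bsub>A\<^esub> U g = U (gdom G g) \<and>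
        U g \<otimes>\<^bsub>A\<^esub> star A (U g) = U (gcod G g)) \<and>
     (\<forall>g\<in>arrows G. \<forall>h\<in>arrows G. U g \<otimes>\<^bsub>A\<^esub> U h =
        (if gdom G g = gcod G h then U (gmul G g h) else \<zero>\<^bsub>A\<^esub>))"


section \<open>Enveloping C*-algebras\<close>

text \<open>
  The Hausdorff completion of a *-algebra in a C*-seminorm: Cauchy sequences modulo null sequences.
\<close>

definition null_rel ::
  "('a, 'm) star_alg_scheme \<Rightarrow> ('a \<Rightarrow> real) \<Rightarrow> ((nat \<Rightarrow> 'a) \<times> (nat \<Rightarrow> 'a)) set" where
  "null_rel A p = {(s, t). s \<in> cauchy_seqs A p \<and> t \<in> cauchy_seqs A p \<and>
     (\<lambda>n. p (s n \<ominus>\<^bsub>A\<^esub> t n)) \<longlonglongrightarrow> 0}"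

definition completion ::
  "('a, 'm) star_alg_scheme \<Rightarrow> ('a \<Rightarrow> real) \<Rightarrow> (nat \<Rightarrow> 'a) set normed_star_alg" where
  "completion A p =
     \<lparr>carrier = cauchy_seqs A p // null_rel A p,
      mult = (\<lambda>X Y. \<Union>s\<in>X. \<Union>t\<in>Y. null_rel A p `` {\<lambda>n. s n \<otimes>\<^bsub>A\<^esub> t n}),
      one = null_rel A p `` {\<lambda>_. \<one>\<^bsub>A\<^esub>},
      zero = null_rel A p `` {\<lambda>_. \<zero>\<^bsub>A\<^esub>},
      add = (\<lambda>X Y. \<Union>s\<in>X. \<Union>t\<in>Y. null_rel A p `` {\<lambda>n. s n \<oplus>\<^bsub>A\<^esub> t n}),
      smult = (\<lambda>z X. \<Union>s\<in>X. null_rel A p `` {\<lambda>n. z \<odot>\<^bsub>A\<^esub> s n}),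
      star = (\<lambda>X. \<Union>s\<in>X. null_rel A p `` {\<lambda>n. star A (s n)}),
      cnorm = (\<lambda>X. THE r. \<forall>s\<in>X. (\<lambda>n. p (s n)) \<longlonglongrightarrow> r)\<rparr>"

text \<open>
  The norm of a *-algebra element in its enveloping C*-algebra is the largest value of a
  C*-seminorm at it, i.e. the supremum of its norms under all *-homomorphisms to C*-algebras;
  using seminorms avoids quantification over types. For groupoid algebras the supremum is finite,
  and the universal property is proved in \<open>groupoid_cstar_universal\<close> below.
\<close>

definition max_seminorm :: "('a, 'm) star_alg_scheme \<Rightarrow> 'a \<Rightarrow> real" where
  "max_seminorm A a = Sup {p a |p. cstar_seminorm A p}"

definition enveloping_cstar :: "('a, 'm) star_alg_scheme \<Rightarrow> (nat \<Rightarrow> 'a) set normed_star_alg" where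
  "enveloping_cstar A = completion A (max_seminorm A)"

definition env_embed :: "('a, 'm) star_alg_scheme \<Rightarrow> 'a \<Rightarrow> (nat \<Rightarrow> 'a) set" where
  "env_embed A a = null_rel A (max_seminorm A) `` {\<lambda>_. a}"


section \<open>Groupoid C*-algebras\<close>

definition arrow_delta :: "'g \<Rightarrow> 'g \<Rightarrow> complex" where
  "arrow_delta g = (\<lambda>h. if h = g then 1 else 0)"

text \<open>
  The convolution *-algebra of finitely supported functions on the arrows, with
  \<open>\<delta>\<^sub>g * \<delta>\<^sub>h = \<delta>\<^sub>g\<^sub>h\<close> for composable arrows, \<open>\<delta>\<^sub>g * \<delta>\<^sub>h = 0\<close> otherwise, and \<open>\<delta>\<^sub>g\<^sup>* = \<delta>\<^sub>g\<^sub>-\<^sub>1\<close>, the exponent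
  \<open>-1\<close> denoting inversion.
\<close>

definition groupoid_algebra :: "'g groupoid \<Rightarrow> ('g \<Rightarrow> complex) star_alg" where
  "groupoid_algebra G =
     \<lparr>carrier = {f. finite {g. f g \<noteq> 0} \<and> {g. f g \<noteq> 0} \<subseteq> arrows G},
      mult = (\<lambda>f h k. \<Sum>(a, b) \<in> {(a, b). f a \<noteq> 0 \<and> h b \<noteq> 0 \<and> gdom G a = gcod G b \<and> gmul G a b = k}.
        f a * h b),
      one = (\<lambda>g. if g \<in> units G then 1 else 0),
      zero = (\<lambda>_. 0),
      add = (\<lambda>f h g. f g + h g),
      smult = (\<lambda>z f g. z * f g),
      star = (\<lambda>f g. if g \<in> arrows G then cnj (f (ginv G g)) else 0)\<rparr>"

definition groupoid_cstar :: "'g groupoid \<Rightarrow> (nat \<Rightarrow> 'g \<Rightarrow> complex) set normed_star_alg" where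
  "groupoid_cstar G = enveloping_cstar (groupoid_algebra G)"

definition canonical_rep :: "'g groupoid \<Rightarrow> 'g \<Rightarrow> (nat \<Rightarrow> 'g \<Rightarrow> complex) set" where
  "canonical_rep G g = env_embed (groupoid_algebra G) (arrow_delta g)"

text \<open>A group is a groupoid with one unit, so its convolution algebra is the group algebra.\<close>

definition group_cstar :: "'g monoid \<Rightarrow> (nat \<Rightarrow> 'g \<Rightarrow> complex) set normed_star_alg" where
  "group_cstar H = groupoid_cstar (group_groupoid H)"

definition group_canonical_rep :: "'g monoid \<Rightarrow> 'g \<Rightarrow> (nat \<Rightarrow> 'g \<Rightarrow> complex) set" where
  "group_canonical_rep H = canonical_rep (group_groupoid H)"


section \<open>Induced traces\<close>

definition connecting_arrows :: "'g groupoid \<Rightarrow> 'g set \<Rightarrow> 'g \<Rightarrow> ('g \<Rightarrow> 'g) \<Rightarrow> bool" where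
  "connecting_arrows G C x k \<longleftrightarrow>
     (\<forall>y\<in>C. k y \<in> arrows G \<and> gdom G (k y) = x \<and> gcod G (k y) = y) \<and> k x = x"

definition induced_trace ::
  "'g groupoid \<Rightarrow> 'g set \<Rightarrow> 'g \<Rightarrow> ('g \<Rightarrow> 'g) \<Rightarrow> ((nat \<Rightarrow> 'g \<Rightarrow> complex) set \<Rightarrow> complex) \<Rightarrow>
     ((nat \<Rightarrow> 'g \<Rightarrow> complex) set \<Rightarrow> complex) \<Rightarrow> bool" where
  "induced_trace G C x k \<tau> \<tau>' \<longleftrightarrow>
     tracial (groupoid_cstar G) \<tau>' \<and>
     (\<forall>g\<in>arrows G. \<tau>' (canonical_rep G g) =
        (if gdom G g = gcod G g \<and> gcod G g \<in> C
         then \<tau> (group_canonical_rep (isotropy_group G x)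
                   (gmul G (gmul G (ginv G (k (gcod G g))) g) (k (gdom G g))))
         else 0))"


section \<open>The completion is a C*-algebra\<close>

lemma complex_ring_simps [simp]:
  "carrier complex_ring = UNIV" "x \<otimes>\<^bsub>complex_ring\<^esub> y = x * y" "\<one>\<^bsub>complex_ring\<^esub> = 1"
  "\<zero>\<^bsub>complex_ring\<^esub> = 0" "x \<oplus>\<^bsub>complex_ring\<^esub> y = x + y"
  by (simp_all add: complex_ring_def)

lemma cring_complex_ring: "cring complex_ring"
proof (rule cringI)
  show "abelian_group complex_ring"
    by (rule abelian_groupI) (auto simp: algebra_simps intro: exI [of _ "- x" for x])
  show "comm_monoid complex_ring"
    by (rule comm_monoidI) (auto simp: algebra_simps)
qed (auto simp: algebra_simps)

sublocale star_algebra \<subseteq> module complex_ring A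
  by (rule complex_module)

context star_algebra
begin

lemma smult_closed' [simp]: "a \<in> carrier A \<Longrightarrow> z \<odot> a \<in> carrier A"
  using smult_closed by simp

lemma csmult_distr: "a \<in> carrier A \<Longrightarrow> (y + z) \<odot> a = y \<odot> a \<oplus> z \<odot> a"
  using smult_l_distr[of y z a] by simp

lemma csmult_assoc: "a \<in> carrier A \<Longrightarrow> (y * z) \<odot> a = y \<odot> (z \<odot> a)"
  using smult_assoc1[of y z a] by simp

lemma minus_one_ring: "\<ominus>\<^bsub>complex_ring\<^esub> 1 = -1"
  by (rule R.sum_zero_eq_neg[symmetric]) auto

lemma neg_smult: "a \<in> carrier A \<Longrightarrow> \<ominus> a = (-1) \<odot> a"
  using smult_l_minus[of 1 a] smult_one[of a] minus_one_ring by simp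

lemma diff_smult: "\<lbrakk>a \<in> carrier A; b \<in> carrier A\<rbrakk> \<Longrightarrow> a \<ominus> b = a \<oplus> (-1) \<odot> b"
  by (simp add: a_minus_def neg_smult)

lemma diff_closed [simp]: "\<lbrakk>a \<in> carrier A; b \<in> carrier A\<rbrakk> \<Longrightarrow> a \<ominus> b \<in> carrier A"
  by simp

lemma diff_add: "\<lbrakk>a \<in> carrier A; b \<in> carrier A; c \<in> carrier A; e \<in> carrier A\<rbrakk>
   \<Longrightarrow> (a \<oplus> b) \<ominus> (c \<oplus> e) = (a \<ominus> c) \<oplus> (b \<ominus> e)"
  by (simp add: a_minus_def minus_add a_ac)

lemma diff_split: "\<lbrakk>a \<in> carrier A; b \<in> carrier A; c \<in> carrier A\<rbrakk>
   \<Longrightarrow> a \<ominus> c = (a \<ominus> b) \<oplus> (b \<ominus> c)"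
  using r_neg1 by (simp add: a_minus_def a_ac r_neg2)

lemma diff_smult2: "\<lbrakk>a \<in> carrier A; b \<in> carrier A\<rbrakk> \<Longrightarrow> z \<odot> a \<ominus> z \<odot> b = z \<odot> (a \<ominus> b)"
  using smult_assoc1[of "-1" z b] smult_assoc1[of z "-1" b] smult_r_distr[of z a "(-1) \<odot> b"]
  by (simp add: diff_smult)

lemma diff_mult: "\<lbrakk>a \<in> carrier A; b \<in> carrier A; c \<in> carrier A; e \<in> carrier A\<rbrakk>
   \<Longrightarrow> a \<otimes> b \<ominus> c \<otimes> e = a \<otimes> (b \<ominus> e) \<oplus> (a \<ominus> c) \<otimes> e"
  using diff_split[of "a \<otimes> b" "a \<otimes> e" "c \<otimes> e"]
  by (simp add: diff_smult mult_closed mult_distl mult_distr mult_smultl mult_smultr)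

lemma star_diff: "\<lbrakk>a \<in> carrier A; b \<in> carrier A\<rbrakk>
   \<Longrightarrow> star A (a \<ominus> b) = star A a \<ominus> star A b"
  by (simp add: diff_smult star_closed star_add star_smult)

lemma smult_zero_l: "a \<in> carrier A \<Longrightarrow> 0 \<odot> a = \<zero>"
  using smult_l_null[of a] by simp

lemma diff_self [simp]: "a \<in> carrier A \<Longrightarrow> a \<ominus> a = \<zero>"
  by (simp add: a_minus_def r_neg)

lemma diff_zero [simp]: "a \<in> carrier A \<Longrightarrow> a \<ominus> \<zero> = a"
  by (simp add: a_minus_def)

lemma diff_eq_zero: "\<lbrakk>a \<in> carrier A; b \<in> carrier A; a \<ominus> b = \<zero>\<rbrakk> \<Longrightarrow> a = b"
  using diff_split[of a b "\<zero>"] by simp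

lemma diff_neg: "\<lbrakk>a \<in> carrier A; b \<in> carrier A\<rbrakk> \<Longrightarrow> (-1) \<odot> (a \<ominus> b) = b \<ominus> a"
  using neg_smult[of "a \<ominus> b"] by (simp add: a_minus_def minus_add a_comm)

end

locale cstar_seminormed = star_algebra A for A :: "('a, 'm) star_alg_scheme" (structure) +
  fixes p :: "'a \<Rightarrow> real"
  assumes p: "cstar_seminorm A p"
begin

abbreviation C where "C \<equiv> cauchy_seqs A p"
abbreviation cl where "cl s \<equiv> null_rel A p `` {s}"
abbreviation K where "K \<equiv> completion A p"

lemma p_nonneg: "a \<in> carrier A \<Longrightarrow> 0 \<le> p a"
  and p_add: "\<lbrakk>a \<in> carrier A; b \<in> carrier A\<rbrakk> \<Longrightarrow> p (a \<oplus> b) \<le> p a + p b"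
  and p_smult: "a \<in> carrier A \<Longrightarrow> p (z \<odot> a) = cmod z * p a"
  and p_mult: "\<lbrakk>a \<in> carrier A; b \<in> carrier A\<rbrakk> \<Longrightarrow> p (a \<otimes> b) \<le> p a * p b"
  and p_cstar: "a \<in> carrier A \<Longrightarrow> p (star A a \<otimes> a) = (p a)\<^sup>2"
  using p by (auto simp: cstar_seminorm_def)

lemma p_zero [simp]: "p \<zero> = 0"
  using p_smult[of "\<zero>" 0] smult_zero_l[of "\<zero>"] by simp

lemma p_diff_comm: "\<lbrakk>a \<in> carrier A; b \<in> carrier A\<rbrakk> \<Longrightarrow> p (a \<ominus> b) = p (b \<ominus> a)"
  using p_smult[of "b \<ominus> a" "-1"] by (simp add: diff_neg)

lemma p_tri: "\<lbrakk>a \<in> carrier A; b \<in> carrier A; c \<in> carrier A\<rbrakk>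
   \<Longrightarrow> p (a \<ominus> c) \<le> p (a \<ominus> b) + p (b \<ominus> c)"
  using diff_split[of a b c] p_add[of "a \<ominus> b" "b \<ominus> c"] by simp

lemma p_abs: assumes "a \<in> carrier A" "b \<in> carrier A" shows "\<bar>p a - p b\<bar> \<le> p (a \<ominus> b)"
  using p_tri[of a b "\<zero>"] p_tri[of b a "\<zero>"] p_diff_comm[of a b] assms by simp

lemma p_star_le: assumes a: "a \<in> carrier A" shows "p a \<le> p (star A a)"
proof (cases "p a = 0")
  case True then show ?thesis using p_nonneg star_closed a by simp
next
  case False
  then have pos: "p a > 0" using p_nonneg[OF a] by simp
  have "p a * p a \<le> p (star A a) * p a"
    using p_mult[of "star A a" a] p_cstar[OF a] a star_closed by (simp add: power2_eq_square)
  then show ?thesis using pos by simp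
qed

lemma p_star: "a \<in> carrier A \<Longrightarrow> p (star A a) = p a"
  using p_star_le[of a] p_star_le[of "star A a"] star_closed star_star by fastforce

lemma Cauchy_carrier: "s \<in> C \<Longrightarrow> s n \<in> carrier A"
  by (simp add: cauchy_seqs_def)

lemma CauchyI: "\<lbrakk>\<And>n. s n \<in> carrier A; \<And>e. e > 0 \<Longrightarrow> \<exists>N. \<forall>m\<ge>N. \<forall>n\<ge>N. p (s m \<ominus> s n) < e\<rbrakk>
   \<Longrightarrow> s \<in> C"
  by (simp add: cauchy_seqs_def)

lemma CauchyE: assumes "s \<in> C" "e > 0" obtains N where "\<And>m n. \<lbrakk>m \<ge> N; n \<ge> N\<rbrakk> \<Longrightarrow> p (s m \<ominus> s n) < e"
  using assms by (fastforce simp: cauchy_seqs_def)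

lemma Cauchy_norm: assumes s: "s \<in> C" shows "Cauchy (\<lambda>n. p (s n))"
proof (rule CauchyI')
  fix e :: real assume "e > 0"
  then obtain N where N: "\<And>m n. \<lbrakk>m \<ge> N; n \<ge> N\<rbrakk> \<Longrightarrow> p (s m \<ominus> s n) < e"
    using s by (meson CauchyE)
  have "norm (p (s m) - p (s n)) < e" if "m \<ge> N" "n \<ge> N" for m n
    using p_abs[of "s m" "s n"] N[of m n] that Cauchy_carrier[OF s] by fastforce
  then show "\<exists>N. \<forall>m\<ge>N. \<forall>n>m. dist (p (s m)) (p (s n)) < e"
    by (metis dist_norm less_or_eq_imp_le order.trans)
qed

lemma norm_conv: "s \<in> C \<Longrightarrow> convergent (\<lambda>n. p (s n))"
  using Cauchy_norm by (simp add: Cauchy_convergent_iff)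

lemma norm_bdd: assumes s: "s \<in> C" obtains B where "B > 0" "\<And>n. p (s n) \<le> B"
proof -
  have "Bseq (\<lambda>n. p (s n))" using Cauchy_norm[OF s] by (rule Cauchy_Bseq)
  then obtain B where "B > 0" "\<And>n. norm (p (s n)) \<le> B" unfolding Bseq_def by blast
  then show thesis using that by (metis abs_le_D1 real_norm_def)
qed

lemma const_C: "a \<in> carrier A \<Longrightarrow> (\<lambda>_. a) \<in> C"
  by (rule CauchyI) auto

lemma add_C: assumes s: "s \<in> C" and t: "t \<in> C" shows "(\<lambda>n. s n \<oplus> t n) \<in> C"
proof (rule CauchyI)
  fix e :: real assume "e > 0"
  then have e: "e / 2 > 0" by simp
  obtain N where N: "\<And>m n. \<lbrakk>m \<ge> N; n \<ge> N\<rbrakk> \<Longrightarrow> p (s m \<ominus> s n) < e / 2"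
    using CauchyE[OF s e] by blast
  obtain M where M: "\<And>m n. \<lbrakk>m \<ge> M; n \<ge> M\<rbrakk> \<Longrightarrow> p (t m \<ominus> t n) < e / 2"
    using CauchyE[OF t e] by blast
  have "p (s m \<oplus> t m \<ominus> (s n \<oplus> t n)) < e" if "m \<ge> max M N" "n \<ge> max M N" for m n
    using N[of m n] M[of m n] p_add[of "s m \<ominus> s n" "t m \<ominus> t n"] that
      Cauchy_carrier[OF s] Cauchy_carrier[OF t] by (simp add: diff_add)
  then show "\<exists>N. \<forall>m\<ge>N. \<forall>n\<ge>N. p (s m \<oplus> t m \<ominus> (s n \<oplus> t n)) < e" by blast
qed (simp add: Cauchy_carrier[OF s] Cauchy_carrier[OF t])

lemma smult_C: assumes s: "s \<in> C" shows "(\<lambda>n. z \<odot> s n) \<in> C"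
proof (rule CauchyI)
  fix e :: real assume e: "e > 0"
  have e': "e / (cmod z + 1) > 0" using e by (simp add: add_nonneg_pos)
  obtain N where N: "\<And>m n. \<lbrakk>m \<ge> N; n \<ge> N\<rbrakk> \<Longrightarrow> p (s m \<ominus> s n) < e / (cmod z + 1)"
    using CauchyE[OF s e'] by blast
  have "p (z \<odot> s m \<ominus> z \<odot> s n) < e" if "m \<ge> N" "n \<ge> N" for m n
  proof -
    have "cmod z * p (s m \<ominus> s n) \<le> cmod z * (e / (cmod z + 1))"
      using N[OF that] by (intro mult_left_mono) auto
    also have "\<dots> < (cmod z + 1) * (e / (cmod z + 1))"
      using e' by (intro mult_strict_right_mono) auto
    also have "\<dots> = e"
      using norm_ge_zero[of z] by (metis add_nonneg_pos less_irrefl nonzero_mult_div_cancel_left times_divide_eq_right zero_less_one)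
    finally show ?thesis using Cauchy_carrier[OF s] by (simp add: diff_smult2 p_smult)
  qed
  then show "\<exists>N. \<forall>m\<ge>N. \<forall>n\<ge>N. p (z \<odot> s m \<ominus> z \<odot> s n) < e" by blast
qed (simp add: Cauchy_carrier[OF s])

lemma star_C: assumes s: "s \<in> C" shows "(\<lambda>n. star A (s n)) \<in> C"
proof (rule CauchyI)
  fix e :: real assume e: "e > 0"
  obtain N where N: "\<And>m n. \<lbrakk>m \<ge> N; n \<ge> N\<rbrakk> \<Longrightarrow> p (s m \<ominus> s n) < e"
    using CauchyE[OF s e] by blast
  then show "\<exists>N. \<forall>m\<ge>N. \<forall>n\<ge>N. p (star A (s m) \<ominus> star A (s n)) < e"
    using Cauchy_carrier[OF s] by (auto simp flip: star_diff simp: p_star)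
qed (simp add: Cauchy_carrier[OF s] star_closed)

lemma p_diff_mult:
  assumes "a \<in> carrier A" "b \<in> carrier A" "c \<in> carrier A" "e \<in> carrier A"
  shows "p (a \<otimes> b \<ominus> c \<otimes> e) \<le> p a * p (b \<ominus> e) + p (a \<ominus> c) * p e"
  using p_add[of "a \<otimes> (b \<ominus> e)" "(a \<ominus> c) \<otimes> e"] p_mult[of a "b \<ominus> e"] p_mult[of "a \<ominus> c" e] assms
  by (simp add: diff_mult mult_closed)

lemma mult_C: assumes s: "s \<in> C" and t: "t \<in> C" shows "(\<lambda>n. s n \<otimes> t n) \<in> C"
proof (rule CauchyI)
  fix e :: real assume "e > 0"
  obtain B where B: "B > 0" "\<And>n. p (s n) \<le> B" using norm_bdd[OF s] by blast
  obtain D where D: "D > 0" "\<And>n. p (t n) \<le> D" using norm_bdd[OF t] by blast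
  have e: "e / (2 * D) > 0" "e / (2 * B) > 0" using \<open>e > 0\<close> B D by auto
  obtain N where N: "\<And>m n. \<lbrakk>m \<ge> N; n \<ge> N\<rbrakk> \<Longrightarrow> p (s m \<ominus> s n) < e / (2 * D)"
    using CauchyE[OF s e(1)] by blast
  obtain M where M: "\<And>m n. \<lbrakk>m \<ge> M; n \<ge> M\<rbrakk> \<Longrightarrow> p (t m \<ominus> t n) < e / (2 * B)"
    using CauchyE[OF t e(2)] by blast
  have "p (s m \<otimes> t m \<ominus> (s n \<otimes> t n)) < e" if mn: "m \<ge> max M N" "n \<ge> max M N" for m n
  proof -
    note car = Cauchy_carrier[OF s] Cauchy_carrier[OF t]
    have "p (s m \<otimes> t m \<ominus> (s n \<otimes> t n)) \<le> p (s m) * p (t m \<ominus> t n) + p (s m \<ominus> s n) * p (t n)"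
      by (rule p_diff_mult) (use car in auto)
    also have "p (s m) * p (t m \<ominus> t n) \<le> B * p (t m \<ominus> t n)"
      using B car p_nonneg by (intro mult_right_mono) auto
    also have "B * p (t m \<ominus> t n) < B * (e / (2 * B))"
      using B M mn by (intro mult_strict_left_mono) auto
    also have "p (s m \<ominus> s n) * p (t n) \<le> (e / (2 * D)) * D"
      using N[of m n] mn D car p_nonneg e by (intro mult_mono) auto
    finally show ?thesis using B D by simp
  qed
  then show "\<exists>N. \<forall>m\<ge>N. \<forall>n\<ge>N. p (s m \<otimes> t m \<ominus> (s n \<otimes> t n)) < e" by blast
qed (simp add: Cauchy_carrier[OF s] Cauchy_carrier[OF t] mult_closed)

lemma null_relD: "(s, t) \<in> null_rel A p \<Longrightarrow> s \<in> C \<and> t \<in> C \<and> (\<lambda>n. p (s n \<ominus> t n)) \<longlonglongrightarrow> 0"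
  by (simp add: null_rel_def)

lemma null_relI: assumes "s \<in> C" "t \<in> C" "X \<longlonglongrightarrow> 0" "\<And>n. p (s n \<ominus> t n) \<le> X n"
  shows "(s, t) \<in> null_rel A p"
proof -
  have "(\<lambda>n. p (s n \<ominus> t n)) \<longlonglongrightarrow> 0"
    by (rule tendsto_sandwich[of "\<lambda>_. 0" _ _ X])
      (use assms Cauchy_carrier p_nonneg in \<open>auto intro!: always_eventually\<close>)
  then show ?thesis using assms by (simp add: null_rel_def)
qed

lemma equiv_null: "equiv C (null_rel A p)"
proof (rule equivI)
  show "null_rel A p \<subseteq> C \<times> C" by (auto simp: null_rel_def)
  show "refl_on C (null_rel A p)"
    by (auto simp: refl_on_def null_rel_def Cauchy_carrier)
  show "sym (null_rel A p)"
  proof (rule symI)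
    fix s t assume "(s, t) \<in> null_rel A p"
    then have *: "s \<in> C" "t \<in> C" "(\<lambda>n. p (s n \<ominus> t n)) \<longlonglongrightarrow> 0" using null_relD by auto
    then show "(t, s) \<in> null_rel A p"
      by (intro null_relI[OF *(2,1,3)]) (simp add: Cauchy_carrier p_diff_comm)
  qed
  show "trans (null_rel A p)"
  proof (rule transI)
    fix s t u assume "(s, t) \<in> null_rel A p" "(t, u) \<in> null_rel A p"
    then have *: "s \<in> C" "t \<in> C" "u \<in> C"
      "(\<lambda>n. p (s n \<ominus> t n)) \<longlonglongrightarrow> 0" "(\<lambda>n. p (t n \<ominus> u n)) \<longlonglongrightarrow> 0" using null_relD by auto
    show "(s, u) \<in> null_rel A p"
      by (rule null_relI[OF *(1,3) tendsto_add_zero[OF *(4,5)]])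
        (intro p_tri; simp add: Cauchy_carrier *)
  qed
qed

lemma cl_eq: "\<lbrakk>s \<in> C; t \<in> C\<rbrakk> \<Longrightarrow> cl s = cl t \<longleftrightarrow> (\<lambda>n. p (s n \<ominus> t n)) \<longlonglongrightarrow> 0"
  using eq_equiv_class_iff[OF equiv_null, of s t] by (simp add: null_rel_def)

lemma cl_carrier: "s \<in> C \<Longrightarrow> cl s \<in> carrier K"
  by (simp add: completion_def quotientI)

lemma carrierE: assumes "X \<in> carrier K" obtains s where "s \<in> C" "X = cl s"
  using assms by (auto simp: completion_def elim: quotientE)

lemma congr2: assumes "\<And>s t. \<lbrakk>s \<in> C; t \<in> C\<rbrakk> \<Longrightarrow> (\<lambda>n. f (s n) (t n)) \<in> C"
  and "\<And>s s' t t'. \<lbrakk>(s, s') \<in> null_rel A p; (t, t') \<in> null_rel A p\<rbrakk> \<Longrightarrow>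
         ((\<lambda>n. f (s n) (t n)), (\<lambda>n. f (s' n) (t' n))) \<in> null_rel A p"
  shows "congruent2 (null_rel A p) (null_rel A p) (\<lambda>s t. cl (\<lambda>n. f (s n) (t n)))"
  by (rule congruent2I') (rule equiv_class_eq[OF equiv_null], erule (1) assms(2))

lemma congr1: assumes "\<And>s. s \<in> C \<Longrightarrow> (\<lambda>n. f (s n)) \<in> C"
  and "\<And>s s'. (s, s') \<in> null_rel A p \<Longrightarrow> ((\<lambda>n. f (s n)), (\<lambda>n. f (s' n))) \<in> null_rel A p"
  shows "congruent (null_rel A p) (\<lambda>s. cl (\<lambda>n. f (s n)))"
  by (rule congruentI) (rule equiv_class_eq[OF equiv_null], erule assms(2))

lemma add_cl: assumes "s \<in> C" "t \<in> C" shows "cl s \<oplus>\<^bsub>K\<^esub> cl t = cl (\<lambda>n. s n \<oplus> t n)"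
proof -
  have "congruent2 (null_rel A p) (null_rel A p) (\<lambda>s t. cl (\<lambda>n. s n \<oplus> t n))"
  proof (rule congr2)
    fix s s' t t' assume "(s, s') \<in> null_rel A p" "(t, t') \<in> null_rel A p"
    then have *: "s \<in> C" "s' \<in> C" "t \<in> C" "t' \<in> C"
      "(\<lambda>n. p (s n \<ominus> s' n)) \<longlonglongrightarrow> 0" "(\<lambda>n. p (t n \<ominus> t' n)) \<longlonglongrightarrow> 0" using null_relD by auto
    show "((\<lambda>n. s n \<oplus> t n), (\<lambda>n. s' n \<oplus> t' n)) \<in> null_rel A p"
      by (rule null_relI[OF add_C[OF *(1,3)] add_C[OF *(2,4)] tendsto_add_zero[OF *(5,6)]])
        (use * in \<open>simp add: diff_add Cauchy_carrier p_add\<close>)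
  qed (rule add_C)
  from UN_equiv_class2[OF equiv_null equiv_null this assms] show ?thesis
    by (simp add: completion_def)
qed

lemma mult_cl: assumes "s \<in> C" "t \<in> C" shows "cl s \<otimes>\<^bsub>K\<^esub> cl t = cl (\<lambda>n. s n \<otimes> t n)"
proof -
  have "congruent2 (null_rel A p) (null_rel A p) (\<lambda>s t. cl (\<lambda>n. s n \<otimes> t n))"
  proof (rule congr2)
    fix s s' t t' assume "(s, s') \<in> null_rel A p" "(t, t') \<in> null_rel A p"
    then have *: "s \<in> C" "s' \<in> C" "t \<in> C" "t' \<in> C"
      "(\<lambda>n. p (s n \<ominus> s' n)) \<longlonglongrightarrow> 0" "(\<lambda>n. p (t n \<ominus> t' n)) \<longlonglongrightarrow> 0" using null_relD by auto
    obtain B where B: "B > 0" "\<And>n. p (s n) \<le> B" using norm_bdd[OF *(1)] by blast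
    obtain D where D: "D > 0" "\<And>n. p (t' n) \<le> D" using norm_bdd[OF *(4)] by blast
    have lim: "(\<lambda>n. B * p (t n \<ominus> t' n) + p (s n \<ominus> s' n) * D) \<longlonglongrightarrow> 0"
      by (intro tendsto_add_zero tendsto_mult_right_zero tendsto_mult_left_zero *(5,6))
    show "((\<lambda>n. s n \<otimes> t n), (\<lambda>n. s' n \<otimes> t' n)) \<in> null_rel A p"
    proof (rule null_relI[OF mult_C[OF *(1,3)] mult_C[OF *(2,4)] lim])
      fix n
      have "p (s n \<otimes> t n \<ominus> s' n \<otimes> t' n) \<le> p (s n) * p (t n \<ominus> t' n) + p (s n \<ominus> s' n) * p (t' n)"
        by (rule p_diff_mult) (use * Cauchy_carrier in auto)
      also have "\<dots> \<le> B * p (t n \<ominus> t' n) + p (s n \<ominus> s' n) * D"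
        using B D * Cauchy_carrier p_nonneg by (intro add_mono mult_mono) auto
      finally show "p (s n \<otimes> t n \<ominus> s' n \<otimes> t' n) \<le> \<dots>" .
    qed
  qed (rule mult_C)
  from UN_equiv_class2[OF equiv_null equiv_null this assms] show ?thesis
    by (simp add: completion_def)
qed

lemma smult_cl: assumes "s \<in> C" shows "z \<odot>\<^bsub>K\<^esub> cl s = cl (\<lambda>n. z \<odot> s n)"
proof -
  have "congruent (null_rel A p) (\<lambda>s. cl (\<lambda>n. z \<odot> s n))"
  proof (rule congr1)
    fix s s' assume "(s, s') \<in> null_rel A p"
    then have *: "s \<in> C" "s' \<in> C" "(\<lambda>n. p (s n \<ominus> s' n)) \<longlonglongrightarrow> 0" using null_relD by auto
    show "((\<lambda>n. z \<odot> s n), (\<lambda>n. z \<odot> s' n)) \<in> null_rel A p"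
      by (rule null_relI[OF smult_C[OF *(1)] smult_C[OF *(2)] tendsto_mult_right_zero[OF *(3), of "cmod z"]])
        (use * in \<open>simp add: diff_smult2 Cauchy_carrier p_smult\<close>)
  qed (rule smult_C)
  from UN_equiv_class[OF equiv_null this assms] show ?thesis
    by (simp add: completion_def)
qed

lemma star_cl: assumes "s \<in> C" shows "star K (cl s) = cl (\<lambda>n. star A (s n))"
proof -
  have "congruent (null_rel A p) (\<lambda>s. cl (\<lambda>n. star A (s n)))"
  proof (rule congr1)
    fix s s' assume "(s, s') \<in> null_rel A p"
    then have *: "s \<in> C" "s' \<in> C" "(\<lambda>n. p (s n \<ominus> s' n)) \<longlonglongrightarrow> 0" using null_relD by auto
    show "((\<lambda>n. star A (s n)), (\<lambda>n. star A (s' n))) \<in> null_rel A p"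
      by (rule null_relI[OF star_C[OF *(1)] star_C[OF *(2)] *(3)])
        (use * in \<open>simp add: star_diff[symmetric] Cauchy_carrier p_star\<close>)
  qed (rule star_C)
  from UN_equiv_class[OF equiv_null this assms] show ?thesis
    by (simp add: completion_def)
qed

lemma zero_cl: "\<zero>\<^bsub>K\<^esub> = cl (\<lambda>_. \<zero>)"
  by (simp add: completion_def)

lemma norm_cl: assumes s: "s \<in> C" shows "(\<lambda>n. p (s n)) \<longlonglongrightarrow> cnorm K (cl s)"
proof -
  obtain r where r: "(\<lambda>n. p (s n)) \<longlonglongrightarrow> r" using norm_conv[OF s] by (auto simp: convergent_def)
  have all: "\<forall>t\<in>cl s. (\<lambda>n. p (t n)) \<longlonglongrightarrow> r"
  proof
    fix t assume "t \<in> cl s"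
    then have *: "t \<in> C" "(\<lambda>n. p (s n \<ominus> t n)) \<longlonglongrightarrow> 0" using null_relD by auto
    have "(\<lambda>n. p (s n) - p (t n)) \<longlonglongrightarrow> 0"
      by (rule tendsto_rabs_zero_cancel, rule tendsto_sandwich[OF _ _ tendsto_const *(2)])
        (use s * Cauchy_carrier p_abs in \<open>auto intro!: always_eventually\<close>)
    from tendsto_diff[OF r this] show "(\<lambda>n. p (t n)) \<longlonglongrightarrow> r" by simp
  qed
  have sin: "s \<in> cl s" using s equiv_class_self[OF equiv_null] by blast
  have "(THE r. \<forall>t\<in>cl s. (\<lambda>n. p (t n)) \<longlonglongrightarrow> r) = r"
    using all sin LIMSEQ_unique by (intro the_equality) blast+
  then show ?thesis using r by (simp add: completion_def)
qed

lemmas cl_simps = add_cl mult_cl smult_cl star_cl zero_cl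
lemmas C_intros = add_C mult_C smult_C star_C const_C

lemma star_algebra_completion: "star_algebra K"
proof (rule star_algebra.intro)
  have ag: "abelian_group K"
  proof (rule abelian_groupI)
    fix x assume "x \<in> carrier K"
    then obtain s where s: "s \<in> C" "x = cl s" by (rule carrierE)
    have "cl (\<lambda>n. (-1) \<odot> s n) \<oplus>\<^bsub>K\<^esub> x = \<zero>\<^bsub>K\<^esub>"
      using s diff_smult[of "s n" "s n" for n] Cauchy_carrier[OF s(1)]
      by (simp add: cl_simps C_intros a_comm)
    then show "\<exists>y\<in>carrier K. y \<oplus>\<^bsub>K\<^esub> x = \<zero>\<^bsub>K\<^esub>"
      using s cl_carrier C_intros by meson
  qed (auto elim!: carrierE simp: cl_simps C_intros Cauchy_carrier a_ac intro!: cl_carrier C_intros)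
  show "module complex_ring K"
    by (rule moduleI[OF cring_complex_ring ag])
      (auto elim!: carrierE simp: cl_simps C_intros Cauchy_carrier csmult_distr smult_r_distr
        csmult_assoc smult_one[simplified] intro!: cl_carrier C_intros)
qed (auto elim!: carrierE simp: cl_simps C_intros Cauchy_carrier mult_assoc mult_distl mult_distr
       mult_smultl mult_smultr star_closed star_add star_smult star_mult star_star
       intro!: cl_carrier C_intros)

lemma cstar_seminorm_completion: "cstar_seminorm K (cnorm K)"
  unfolding cstar_seminorm_def
proof (intro conjI ballI allI)
  fix X assume "X \<in> carrier K" then obtain s where s: "s \<in> C" "X = cl s" by (rule carrierE)
  note ns = norm_cl[OF s(1)] and cs = Cauchy_carrier[OF s(1)]
  show "0 \<le> cnorm K X" using LIMSEQ_le_const[OF ns, of 0] cs p_nonneg s by auto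
  show "cnorm K (z \<odot>\<^bsub>K\<^esub> X) = cmod z * cnorm K X" for z
    using LIMSEQ_unique[OF norm_cl[OF smult_C[OF s(1)], of z] tendsto_mult_left[OF ns, of "cmod z", folded p_smult[OF cs]]]
    using s by (simp add: cl_simps)
  show "cnorm K (star K X \<otimes>\<^bsub>K\<^esub> X) = (cnorm K X)\<^sup>2"
    using LIMSEQ_unique[OF norm_cl[OF mult_C[OF star_C[OF s(1)] s(1)]]
        tendsto_power[OF ns, of 2, folded p_cstar[OF cs]]]
    using s by (simp add: cl_simps C_intros)
  fix Y assume "Y \<in> carrier K" then obtain t where t: "t \<in> C" "Y = cl t" by (rule carrierE)
  note nt = norm_cl[OF t(1)] and ct = Cauchy_carrier[OF t(1)]
  show "cnorm K (X \<oplus>\<^bsub>K\<^esub> Y) \<le> cnorm K X + cnorm K Y"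
    using LIMSEQ_le[OF norm_cl[OF add_C[OF s(1) t(1)]] tendsto_add[OF ns nt]] p_add[OF cs ct] s t
    by (simp add: cl_simps)
  show "cnorm K (X \<otimes>\<^bsub>K\<^esub> Y) \<le> cnorm K X * cnorm K Y"
    using LIMSEQ_le[OF norm_cl[OF mult_C[OF s(1) t(1)]] tendsto_mult[OF ns nt]] p_mult[OF cs ct] s t
    by (simp add: cl_simps)
qed

end

context cstar_seminormed
begin

lemma emb_diff_norm: assumes "s \<in> C" "a \<in> carrier A"
  shows "(\<lambda>n. p (s n \<ominus> a)) \<longlonglongrightarrow> cnorm K (cl s \<ominus>\<^bsub>K\<^esub> cl (\<lambda>_. a))"
proof -
  interpret Kalg: star_algebra K by (rule star_algebra_completion)
  have "cl s \<ominus>\<^bsub>K\<^esub> cl (\<lambda>_. a) = cl (\<lambda>n. s n \<ominus> a)"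
    using assms Cauchy_carrier[OF assms(1)]
    by (simp add: Kalg.diff_smult cl_carrier C_intros cl_simps diff_smult)
  moreover have "(\<lambda>n. s n \<ominus> a) \<in> C"
    using add_C[OF assms(1) smult_C[OF const_C[OF assms(2)], of "-1"]] assms Cauchy_carrier[OF assms(1)]
    by (simp add: diff_smult)
  ultimately show ?thesis using norm_cl by simp
qed

lemma emb_dense: assumes "X \<in> carrier K" "e > 0"
  shows "\<exists>a\<in>carrier A. cnorm K (X \<ominus>\<^bsub>K\<^esub> cl (\<lambda>_. a)) \<le> e"
proof -
  obtain s where s: "s \<in> C" "X = cl s" using assms carrierE by blast
  obtain N where N: "\<And>m n. \<lbrakk>m \<ge> N; n \<ge> N\<rbrakk> \<Longrightarrow> p (s m \<ominus> s n) < e"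
    using CauchyE[OF s(1) assms(2)] by blast
  have "cnorm K (X \<ominus>\<^bsub>K\<^esub> cl (\<lambda>_. s N)) \<le> e"
    using LIMSEQ_le_const2[OF emb_diff_norm[OF s(1) Cauchy_carrier[OF s(1), of N]], of e] N s
    by (meson less_imp_le order_refl)
  then show ?thesis using Cauchy_carrier[OF s(1)] by blast
qed

lemma emb_norm: assumes "a \<in> carrier A" shows "cnorm K (cl (\<lambda>_. a)) = p a"
  using norm_cl[OF const_C[OF assms]] LIMSEQ_const_iff by metis

lemma emb_diff: assumes "a \<in> carrier A" "b \<in> carrier A"
  shows "cl (\<lambda>_. a) \<ominus>\<^bsub>K\<^esub> cl (\<lambda>_. b) = cl (\<lambda>_. a \<ominus> b)"
proof -
  interpret Kalg: star_algebra K by (rule star_algebra_completion)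
  show ?thesis using assms by (simp add: Kalg.diff_smult cl_carrier C_intros cl_simps diff_smult)
qed

lemma completion_complete:
  assumes S: "S \<in> cauchy_seqs K (cnorm K)"
  shows "\<exists>X\<in>carrier K. (\<lambda>n. cnorm K (S n \<ominus>\<^bsub>K\<^esub> X)) \<longlonglongrightarrow> 0"
proof -
  interpret Kn: cstar_seminormed K "cnorm K"
    using star_algebra_completion cstar_seminorm_completion
    by (simp add: cstar_seminormed_def cstar_seminormed_axioms_def)
  note Sc = Kn.Cauchy_carrier[OF S]
  have "\<forall>n. \<exists>a\<in>carrier A. cnorm K (S n \<ominus>\<^bsub>K\<^esub> cl (\<lambda>_. a)) \<le> inverse (real (Suc n))"
    using emb_dense[OF Sc] by simp
  then obtain t where t: "\<And>n. t n \<in> carrier A"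
      "\<And>n. cnorm K (S n \<ominus>\<^bsub>K\<^esub> cl (\<lambda>_. t n)) \<le> inverse (real (Suc n))"
    by metis
  note emb = cl_carrier[OF const_C[OF t(1)]]
  have bound: "p (t m \<ominus> t n) \<le> inverse (real (Suc m)) + cnorm K (S m \<ominus>\<^bsub>K\<^esub> S n) + inverse (real (Suc n))"
    for m n
  proof -
    have "p (t m \<ominus> t n) = cnorm K (cl (\<lambda>_. t m) \<ominus>\<^bsub>K\<^esub> cl (\<lambda>_. t n))"
      using t by (simp add: emb_diff emb_norm)
    also have "\<dots> \<le> cnorm K (cl (\<lambda>_. t m) \<ominus>\<^bsub>K\<^esub> S m) + cnorm K (S m \<ominus>\<^bsub>K\<^esub> cl (\<lambda>_. t n))"
      by (rule Kn.p_tri) (use emb Sc in auto)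
    also have "cnorm K (S m \<ominus>\<^bsub>K\<^esub> cl (\<lambda>_. t n))
       \<le> cnorm K (S m \<ominus>\<^bsub>K\<^esub> S n) + cnorm K (S n \<ominus>\<^bsub>K\<^esub> cl (\<lambda>_. t n))"
      by (rule Kn.p_tri) (use emb Sc in auto)
    finally show ?thesis
      using t(2)[of m] t(2)[of n] Kn.p_diff_comm[OF emb[of m] Sc[of m]] by linarith
  qed
  have small: "\<exists>N. \<forall>n\<ge>N. inverse (real (Suc n)) < e" if "e > 0" for e
  proof -
    from reals_Archimedean[OF \<open>e > 0\<close>] obtain N where "inverse (real (Suc N)) < e" by blast
    moreover have "inverse (real (Suc n)) \<le> inverse (real (Suc N))" if "n \<ge> N" for n
      using that by (simp add: le_imp_inverse_le)
    ultimately show ?thesis by (meson le_less_trans)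
  qed
  have tC: "t \<in> C"
  proof (rule CauchyI)
    fix e :: real assume "e > 0"
    then have e: "e / 3 > 0" by simp
    obtain M where M: "\<And>n. n \<ge> M \<Longrightarrow> inverse (real (Suc n)) < e / 3" using small[OF e] by blast
    obtain N where N: "\<And>m n. \<lbrakk>m \<ge> N; n \<ge> N\<rbrakk> \<Longrightarrow> cnorm K (S m \<ominus>\<^bsub>K\<^esub> S n) < e / 3"
      using Kn.CauchyE[OF S e] by blast
    have "p (t m \<ominus> t n) < e" if "m \<ge> max M N" "n \<ge> max M N" for m n
      using bound[of m n] M[of m] M[of n] N[of m n] that by fastforce
    then show "\<exists>N. \<forall>m\<ge>N. \<forall>n\<ge>N. p (t m \<ominus> t n) < e" by blast
  qed (rule t)
  have "(\<lambda>n. cnorm K (S n \<ominus>\<^bsub>K\<^esub> cl t)) \<longlonglongrightarrow> 0"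
  proof (rule LIMSEQ_I)
    fix e :: real assume "e > 0"
    then have e: "e / 3 > 0" by simp
    obtain M where M: "\<And>n. n \<ge> M \<Longrightarrow> inverse (real (Suc n)) < e / 3" using small[OF e] by blast
    obtain N where N: "\<And>m n. \<lbrakk>m \<ge> N; n \<ge> N\<rbrakk> \<Longrightarrow> p (t m \<ominus> t n) < e / 3"
      using CauchyE[OF tC e] by blast
    have "norm (cnorm K (S n \<ominus>\<^bsub>K\<^esub> cl t) - 0) < e" if n: "n \<ge> max M N" for n
    proof -
      have "cnorm K (cl t \<ominus>\<^bsub>K\<^esub> cl (\<lambda>_. t n)) \<le> e / 3"
        using LIMSEQ_le_const2[OF emb_diff_norm[OF tC t(1)[of n]], of "e / 3"] N n
        by (metis less_imp_le max.boundedE)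
      moreover have "cnorm K (S n \<ominus>\<^bsub>K\<^esub> cl t)
         \<le> cnorm K (S n \<ominus>\<^bsub>K\<^esub> cl (\<lambda>_. t n)) + cnorm K (cl (\<lambda>_. t n) \<ominus>\<^bsub>K\<^esub> cl t)"
        by (rule Kn.p_tri) (use emb Sc cl_carrier[OF tC] in auto)
      moreover have "cnorm K (cl (\<lambda>_. t n) \<ominus>\<^bsub>K\<^esub> cl t) = cnorm K (cl t \<ominus>\<^bsub>K\<^esub> cl (\<lambda>_. t n))"
        by (rule Kn.p_diff_comm) (use emb cl_carrier[OF tC] in auto)
      moreover have "cnorm K (S n \<ominus>\<^bsub>K\<^esub> cl t) \<ge> 0"
        by (rule Kn.p_nonneg) (use Sc cl_carrier[OF tC] in auto)
      moreover have "inverse (real (Suc n)) < e / 3" using M[of n] n by simp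
      ultimately show ?thesis using t(2)[of n] \<open>e > 0\<close> unfolding real_norm_def diff_zero by linarith
    qed
    then show "\<exists>no. \<forall>n\<ge>no. norm (cnorm K (S n \<ominus>\<^bsub>K\<^esub> cl t) - 0) < e" by blast
  qed
  then show ?thesis using cl_carrier[OF tC] by blast
qed

theorem cstar_algebra_completion: "cstar_algebra K"
proof (intro cstar_algebra.intro star_algebra_completion cstar_algebra_axioms.intro
    cstar_seminorm_completion)
  fix X assume "X \<in> carrier K" "cnorm K X = 0"
  moreover from this obtain s where s: "s \<in> C" "X = cl s" using carrierE by blast
  ultimately have "(\<lambda>n. p (s n)) \<longlonglongrightarrow> 0" using norm_cl by force
  then show "X = \<zero>\<^bsub>K\<^esub>"
    using s Cauchy_carrier[OF s(1)] by (simp add: zero_cl cl_eq const_C)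
qed (rule completion_complete)

end

lemma (in cstar_algebra) cstar_seminormed: "cstar_seminormed A (cnorm A)"
  using star_algebra_axioms cstar_norm
  by (simp add: cstar_seminormed_def cstar_seminormed_axioms_def)

text \<open>A *-homomorphism to a C*-algebra dominated by \<open>p\<close> extends to the completion.\<close>

lemma (in cstar_seminormed) completion_extend:
  fixes B :: "('b, 'n) normed_star_alg_scheme"
  assumes B: "cstar_algebra B" and f: "star_hom A B f"
    and bd: "\<And>a. a \<in> carrier A \<Longrightarrow> cnorm B (f a) \<le> p a"
  shows "\<exists>F. star_hom K B F \<and> (\<forall>X\<in>carrier K. cnorm B (F X) \<le> cnorm K X) \<and>
           (\<forall>a\<in>carrier A. F (cl (\<lambda>_. a)) = f a)"
proof -
  interpret B: cstar_algebra B by (rule B)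
  interpret Bn: cstar_seminormed B "cnorm B" by (rule B.cstar_seminormed)
  have fc: "f a \<in> carrier B" if "a \<in> carrier A" for a using f that by (auto simp: star_hom_def)
  have f_add: "f (a \<oplus> b) = f a \<oplus>\<^bsub>B\<^esub> f b" and f_mult: "f (a \<otimes> b) = f a \<otimes>\<^bsub>B\<^esub> f b"
    if "a \<in> carrier A" "b \<in> carrier A" for a b using f that by (auto simp: star_hom_def)
  have f_smult: "f (z \<odot> a) = z \<odot>\<^bsub>B\<^esub> f a" and f_star: "f (star A a) = star B (f a)"
    if "a \<in> carrier A" for a z using f that by (auto simp: star_hom_def)
  have f_diff: "f (a \<ominus> b) = f a \<ominus>\<^bsub>B\<^esub> f b" if "a \<in> carrier A" "b \<in> carrier A" for a b
    using that by (simp add: diff_smult B.diff_smult f_add f_smult fc)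
  define lm where "lm = (\<lambda>s b. b \<in> carrier B \<and> (\<lambda>n. cnorm B (f (s n) \<ominus>\<^bsub>B\<^esub> b)) \<longlonglongrightarrow> 0)"
  have squeeze: "(\<lambda>n. cnorm B (x n)) \<longlonglongrightarrow> 0"
    if "y \<longlonglongrightarrow> 0" "\<And>n. cnorm B (x n) \<le> y n" "\<And>n. x n \<in> carrier B" for x y
    by (rule tendsto_sandwich[OF _ _ tendsto_const that(1)])
      (use that Bn.p_nonneg in \<open>auto intro!: always_eventually\<close>)
  have lm_ex: "\<exists>b. lm s b" if s: "s \<in> C" for s
  proof -
    have "(\<lambda>n. f (s n)) \<in> cauchy_seqs B (cnorm B)"
    proof (rule Bn.CauchyI)
      fix e :: real assume "e > 0"
      then obtain N where N: "\<And>m n. \<lbrakk>m \<ge> N; n \<ge> N\<rbrakk> \<Longrightarrow> p (s m \<ominus> s n) < e"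
        using CauchyE[OF s] by blast
      have "cnorm B (f (s m) \<ominus>\<^bsub>B\<^esub> f (s n)) < e" if "m \<ge> N" "n \<ge> N" for m n
        using N[OF that] bd[of "s m \<ominus> s n"] Cauchy_carrier[OF s] by (fastforce simp: f_diff)
      then show "\<exists>N. \<forall>m\<ge>N. \<forall>n\<ge>N. cnorm B (f (s m) \<ominus>\<^bsub>B\<^esub> f (s n)) < e" by blast
    qed (simp add: fc Cauchy_carrier[OF s])
    from B.norm_complete[OF this] show ?thesis unfolding lm_def by blast
  qed
  have lm_unique: "b = c"
    if "lm s b" "lm t c" "s \<in> C" "t \<in> C" "(\<lambda>n. p (s n \<ominus> t n)) \<longlonglongrightarrow> 0" for s t b c
  proof -
    have bc: "b \<in> carrier B" "c \<in> carrier B" using that by (auto simp: lm_def)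
    have fs: "f (s n) \<in> carrier B" "f (t n) \<in> carrier B" for n
      using fc Cauchy_carrier that by auto
    have l: "(\<lambda>n. cnorm B (f (s n) \<ominus>\<^bsub>B\<^esub> b) + p (s n \<ominus> t n) + cnorm B (f (t n) \<ominus>\<^bsub>B\<^esub> c)) \<longlonglongrightarrow> 0"
      using that unfolding lm_def by (intro tendsto_add_zero) auto
    have "cnorm B (b \<ominus>\<^bsub>B\<^esub> c)
        \<le> cnorm B (f (s n) \<ominus>\<^bsub>B\<^esub> b) + p (s n \<ominus> t n) + cnorm B (f (t n) \<ominus>\<^bsub>B\<^esub> c)" for n
      using Bn.p_tri[OF bc(1) fs(1)[of n] bc(2)] Bn.p_tri[OF fs(1)[of n] fs(2)[of n] bc(2)]
        bd[of "s n \<ominus> t n"] Bn.p_diff_comm[OF bc(1) fs(1)[of n]] Cauchy_carrier[OF that(3)]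
        Cauchy_carrier[OF that(4)] by (fastforce simp: f_diff)
    then have "cnorm B (b \<ominus>\<^bsub>B\<^esub> c) \<le> 0" using LIMSEQ_le_const[OF l] by blast
    then have z: "b \<ominus>\<^bsub>B\<^esub> c = \<zero>\<^bsub>B\<^esub>"
      using bc Bn.p_nonneg[of "b \<ominus>\<^bsub>B\<^esub> c"] by (intro B.norm_definite) auto
    then show ?thesis using bc B.diff_eq_zero by blast
  qed
  define F where "F = (\<lambda>X. SOME b. \<exists>s\<in>X. lm s b)"
  have F: "lm s (F (cl s))" if s: "s \<in> C" for s
  proof -
    have sin: "s \<in> cl s" using s equiv_class_self[OF equiv_null] by blast
    have "\<exists>t\<in>cl s. lm t (F (cl s))"
      unfolding F_def by (rule someI_ex) (use sin lm_ex[OF s] in blast)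
    then obtain t where t: "t \<in> cl s" "lm t (F (cl s))" by blast
    obtain b where b: "lm s b" using lm_ex[OF s] by blast
    have "b = F (cl s)"
      using lm_unique[OF b t(2) s] t(1) null_relD by blast
    then show ?thesis using b by simp
  qed
  have FI: "F (cl s) = b" if "s \<in> C" "lm s b" for s b
    using lm_unique[OF F[OF that(1)] that(2) that(1) that(1)] Cauchy_carrier[OF that(1)] by simp
  have Fe: "F (cl (\<lambda>_. a)) = f a" if "a \<in> carrier A" for a
    by (rule FI[OF const_C[OF that]]) (simp add: lm_def fc that)
  have "star_hom K B F"
    unfolding star_hom_def
  proof (intro conjI ballI allI funcsetI)
    fix X assume "X \<in> carrier K" then obtain s where s: "s \<in> C" "X = cl s" by (rule carrierE)
    note cs = Cauchy_carrier[OF s(1)]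
    have ls: "F X \<in> carrier B" "(\<lambda>n. cnorm B (f (s n) \<ominus>\<^bsub>B\<^esub> F X)) \<longlonglongrightarrow> 0"
      using F[OF s(1)] s by (auto simp: lm_def)
    show "F X \<in> carrier B" by (rule ls)
    show "F (z \<odot>\<^bsub>K\<^esub> X) = z \<odot>\<^bsub>B\<^esub> F X" for z
      unfolding s smult_cl[OF s(1)]
    proof (rule FI[OF smult_C[OF s(1)]])
      show "lm (\<lambda>n. z \<odot> s n) (z \<odot>\<^bsub>B\<^esub> F (cl s))"
        unfolding lm_def
        by (intro conjI squeeze[OF tendsto_mult_right_zero[OF ls(2), of "cmod z"]])
          (use ls cs s in \<open>auto simp: f_smult B.diff_smult2 Bn.p_smult fc\<close>)
    qed
    show "F (star K X) = star B (F X)"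
      unfolding s star_cl[OF s(1)]
    proof (rule FI[OF star_C[OF s(1)]])
      show "lm (\<lambda>n. star A (s n)) (star B (F (cl s)))"
        unfolding lm_def
        by (intro conjI squeeze[OF ls(2)])
          (use ls cs s in \<open>auto simp: f_star B.star_diff[symmetric] Bn.p_star fc B.star_closed\<close>)
    qed
    fix Y assume "Y \<in> carrier K" then obtain t where t: "t \<in> C" "Y = cl t" by (rule carrierE)
    note ct = Cauchy_carrier[OF t(1)]
    have lt: "F Y \<in> carrier B" "(\<lambda>n. cnorm B (f (t n) \<ominus>\<^bsub>B\<^esub> F Y)) \<longlonglongrightarrow> 0"
      using F[OF t(1)] t by (auto simp: lm_def)
    show "F (X \<oplus>\<^bsub>K\<^esub> Y) = F X \<oplus>\<^bsub>B\<^esub> F Y"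
      unfolding s(2) t(2) add_cl[OF s(1) t(1)]
    proof (rule FI[OF add_C[OF s(1) t(1)]])
      show "lm (\<lambda>n. s n \<oplus> t n) (F (cl s) \<oplus>\<^bsub>B\<^esub> F (cl t))"
        unfolding lm_def
        by (intro conjI squeeze[OF tendsto_add_zero[OF ls(2) lt(2)]])
          (use ls cs s lt ct t in \<open>auto simp: f_add B.diff_add Bn.p_add fc\<close>)
    qed
    show "F (X \<otimes>\<^bsub>K\<^esub> Y) = F X \<otimes>\<^bsub>B\<^esub> F Y"
      unfolding s(2) t(2) mult_cl[OF s(1) t(1)]
    proof (rule FI[OF mult_C[OF s(1) t(1)]])
      obtain D where D: "D > 0" "\<And>n. p (s n) \<le> D" using norm_bdd[OF s(1)] by blast
      have l: "(\<lambda>n. D * cnorm B (f (t n) \<ominus>\<^bsub>B\<^esub> F Y) + cnorm B (f (s n) \<ominus>\<^bsub>B\<^esub> F X) * cnorm B (F Y)) \<longlonglongrightarrow> 0"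
        by (intro tendsto_add_zero tendsto_mult_right_zero tendsto_mult_left_zero ls lt)
      have "cnorm B (f (s n) \<otimes>\<^bsub>B\<^esub> f (t n) \<ominus>\<^bsub>B\<^esub> F X \<otimes>\<^bsub>B\<^esub> F Y)
         \<le> D * cnorm B (f (t n) \<ominus>\<^bsub>B\<^esub> F Y) + cnorm B (f (s n) \<ominus>\<^bsub>B\<^esub> F X) * cnorm B (F Y)" for n
      proof -
        have "cnorm B (f (s n) \<otimes>\<^bsub>B\<^esub> f (t n) \<ominus>\<^bsub>B\<^esub> F X \<otimes>\<^bsub>B\<^esub> F Y)
          \<le> cnorm B (f (s n)) * cnorm B (f (t n) \<ominus>\<^bsub>B\<^esub> F Y) + cnorm B (f (s n) \<ominus>\<^bsub>B\<^esub> F X) * cnorm B (F Y)"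
          by (rule Bn.p_diff_mult) (use ls lt cs ct fc in auto)
        moreover have "cnorm B (f (s n)) * cnorm B (f (t n) \<ominus>\<^bsub>B\<^esub> F Y) \<le> D * cnorm B (f (t n) \<ominus>\<^bsub>B\<^esub> F Y)"
          using bd[OF cs, of n] D(2)[of n] lt ct fc Bn.p_nonneg by (intro mult_right_mono) auto
        ultimately show ?thesis by linarith
      qed
      with l show "lm (\<lambda>n. s n \<otimes> t n) (F (cl s) \<otimes>\<^bsub>B\<^esub> F (cl t))"
        unfolding lm_def s(2) t(2)
        by (intro conjI squeeze[OF l[unfolded s(2) t(2)]])
          (use ls cs s lt ct t in \<open>auto simp: f_mult fc B.mult_closed\<close>)
    qed
  qed
  moreover have "cnorm B (F X) \<le> cnorm K X" if "X \<in> carrier K" for X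
  proof -
    obtain s where s: "s \<in> C" "X = cl s" using \<open>X \<in> carrier K\<close> by (rule carrierE)
    note cs = Cauchy_carrier[OF s(1)]
    have ls: "F X \<in> carrier B" "(\<lambda>n. cnorm B (f (s n) \<ominus>\<^bsub>B\<^esub> F X)) \<longlonglongrightarrow> 0"
      using F[OF s(1)] s by (auto simp: lm_def)
    have "(\<lambda>n. p (s n) + cnorm B (f (s n) \<ominus>\<^bsub>B\<^esub> F X)) \<longlonglongrightarrow> cnorm K X + 0"
      unfolding s(2) by (intro tendsto_add norm_cl[OF s(1)] ls[unfolded s(2)])
    moreover have "cnorm B (F X) \<le> p (s n) + cnorm B (f (s n) \<ominus>\<^bsub>B\<^esub> F X)" for n
      using Bn.p_abs[OF fc[OF cs] ls(1), of n] bd[OF cs, of n] by linarith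
    ultimately show ?thesis using LIMSEQ_le_const[of _ "cnorm K X + 0"] by fastforce
  qed
  ultimately show ?thesis using Fe by blast
qed


section \<open>The universal property\<close>

context groupoid
begin

abbreviation CG where "CG \<equiv> groupoid_algebra G"
abbreviation conv where "conv \<equiv> mult CG"

lemma CG_carrier: "f \<in> carrier CG \<longleftrightarrow> finite {g. f g \<noteq> 0} \<and> {g. f g \<noteq> 0} \<subseteq> arrows G"
  by (simp add: groupoid_algebra_def)

lemma CG_memI: assumes "{g. f g \<noteq> 0} \<subseteq> W" "finite W" "W \<subseteq> arrows G" shows "f \<in> carrier CG"
  unfolding CG_carrier by (intro conjI finite_subset[OF assms(1,2)] subset_trans[OF assms(1,3)])

lemma CG_simps: "f \<oplus>\<^bsub>CG\<^esub> h = (\<lambda>g. f g + h g)" "z \<odot>\<^bsub>CG\<^esub> f = (\<lambda>g. z * f g)" "\<zero>\<^bsub>CG\<^esub> = (\<lambda>_. 0)"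
  "star CG f = (\<lambda>g. if g \<in> arrows G then cnj (f (ginv G g)) else 0)"
  by (simp_all add: groupoid_algebra_def)

lemma inv_inv: assumes g: "g \<in> arrows G" shows "ginv G (ginv G g) = g"
proof -
  have "ginv G (ginv G g) = gmul G (ginv G (ginv G g)) (gmul G (ginv G g) g)"
    using mul_dom[of "ginv G (ginv G g)"] g by (simp add: inv_mul inv_closed dom_inv cod_inv)
  also have "\<dots> = gmul G (gmul G (ginv G (ginv G g)) (ginv G g)) g"
    using g by (simp add: mul_assoc inv_closed dom_inv cod_inv)
  also have "\<dots> = g"
    using g by (simp add: inv_mul inv_closed dom_inv cod_mul_self)
  finally show ?thesis .
qed

lemma inv_unique: assumes "g \<in> arrows G" "h \<in> arrows G" "gdom G g = gcod G h" "gmul G g h = gcod G g"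
  shows "h = ginv G g"
proof -
  have "h = gmul G (gmul G (ginv G g) g) h"
    using assms by (simp add: inv_mul cod_mul_self)
  also have "\<dots> = gmul G (ginv G g) (gcod G g)"
    using assms by (simp add: mul_assoc inv_closed dom_inv)
  also have "\<dots> = ginv G g"
    using mul_dom[of "ginv G g"] assms by (simp add: inv_closed dom_inv)
  finally show ?thesis .
qed

lemma inv_gmul: assumes g: "g \<in> arrows G" "h \<in> arrows G" "gdom G g = gcod G h"
  shows "ginv G (gmul G g h) = gmul G (ginv G h) (ginv G g)"
proof (rule inv_unique[symmetric])
  have "gmul G (gmul G g h) (gmul G (ginv G h) (ginv G g))
      = gmul G g (gmul G (gmul G h (ginv G h)) (ginv G g))"
    using g by (simp add: mul_assoc mul_closed inv_closed dom_inv cod_inv dom_mul cod_mul)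
  also have "\<dots> = gcod G g"
    using g cod_mul_self[of "ginv G g"] by (simp add: mul_inv inv_closed cod_inv)
  finally show "gmul G (gmul G g h) (gmul G (ginv G h) (ginv G g)) = gcod G (gmul G g h)"
    using g by (simp add: cod_mul)
qed (use g in \<open>simp_all add: mul_closed inv_closed dom_inv cod_inv dom_mul cod_mul\<close>)

lemma delta_carrier: "g \<in> arrows G \<Longrightarrow> arrow_delta g \<in> carrier CG"
  by (simp add: CG_carrier arrow_delta_def)

lemma conv_sum:
  assumes "finite S" "finite T" "{g. f g \<noteq> 0} \<subseteq> S" "{g. h g \<noteq> 0} \<subseteq> T"
  shows "conv f h k = (\<Sum>a\<in>S. \<Sum>b\<in>T. if gdom G a = gcod G b \<and> gmul G a b = k then f a * h b else 0)"
proof -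
  have "conv f h k = (\<Sum>(a, b)\<in>S \<times> T. if gdom G a = gcod G b \<and> gmul G a b = k then f a * h b else 0)"
    unfolding groupoid_algebra_def using assms
    by (auto intro!: sum.mono_neutral_cong_left split: if_splits)
  then show ?thesis by (simp add: sum.cartesian_product)
qed

lemma conv_closed: assumes "f \<in> carrier CG" "h \<in> carrier CG" shows "conv f h \<in> carrier CG"
proof -
  let ?S = "{g. f g \<noteq> 0}" and ?T = "{g. h g \<noteq> 0}"
  have fin: "finite ?S" "finite ?T" using assms by (auto simp: CG_carrier)
  have "{k. conv f h k \<noteq> 0}
      \<subseteq> (\<lambda>(a, b). gmul G a b) ` {(a, b) \<in> ?S \<times> ?T. gdom G a = gcod G b}" (is "_ \<subseteq> ?W")
  proof
    fix k assume "k \<in> {k. conv f h k \<noteq> 0}"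
    then have "(\<Sum>a\<in>?S. \<Sum>b\<in>?T. if gdom G a = gcod G b \<and> gmul G a b = k then f a * h b else 0) \<noteq> 0"
      using conv_sum[OF fin order_refl order_refl] by simp
    from sum.not_neutral_contains_not_neutral[OF this] obtain a where a: "a \<in> ?S"
        "(\<Sum>b\<in>?T. if gdom G a = gcod G b \<and> gmul G a b = k then f a * h b else 0) \<noteq> 0" .
    from sum.not_neutral_contains_not_neutral[OF a(2)] obtain b where "b \<in> ?T" "(if gdom G a = gcod G b \<and> gmul G a b = k then f a * h b else 0) \<noteq> 0" .
    then show "k \<in> ?W" using a by (force split: if_splits)
  qed
  moreover have "finite ?W" using fin by (auto intro: finite_subset[of _ "?S \<times> ?T"])
  moreover have "?W \<subseteq> arrows G" using assms by (auto simp: CG_carrier intro!: mul_closed)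
  ultimately show ?thesis by (rule CG_memI)
qed

lemma add_carrier: assumes "f \<in> carrier CG" "h \<in> carrier CG" shows "(\<lambda>g. f g + h g) \<in> carrier CG"
proof -
  have "{g. f g + h g \<noteq> 0} \<subseteq> {g. f g \<noteq> 0} \<union> {g. h g \<noteq> 0}" by auto
  moreover have "finite ({g. f g \<noteq> 0} \<union> {g. h g \<noteq> 0})" "{g. f g \<noteq> 0} \<union> {g. h g \<noteq> 0} \<subseteq> arrows G"
    using assms by (auto simp: CG_carrier)
  ultimately show ?thesis by (rule CG_memI)
qed

lemma smult_carrier: assumes "f \<in> carrier CG" shows "(\<lambda>g. z * f g) \<in> carrier CG"
proof -
  have "{g. z * f g \<noteq> 0} \<subseteq> {g. f g \<noteq> 0}" by auto
  then show ?thesis by (rule CG_memI) (use assms in \<open>auto simp: CG_carrier\<close>)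
qed

lemma star_carrier: assumes "f \<in> carrier CG" shows "star CG f \<in> carrier CG"
proof -
  have "{g. star CG f g \<noteq> 0} \<subseteq> ginv G ` {g. f g \<noteq> 0}"
  proof
    fix g assume "g \<in> {g. star CG f g \<noteq> 0}"
    then have "g \<in> arrows G" "f (ginv G g) \<noteq> 0" by (auto simp: CG_simps split: if_splits)
    then show "g \<in> ginv G ` {g. f g \<noteq> 0}" 
      by (intro image_eqI[of _ _ "ginv G g"]) (simp_all add: inv_inv)
  qed
  moreover have "finite (ginv G ` {g. f g \<noteq> 0})" "ginv G ` {g. f g \<noteq> 0} \<subseteq> arrows G"
    using assms by (auto simp: CG_carrier inv_closed)
  ultimately show ?thesis by (rule CG_memI)
qed

lemma CG_induct [consumes 1, case_names delta add zero]:
  assumes "f \<in> carrier CG"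
    and delta: "\<And>z g. g \<in> arrows G \<Longrightarrow> P (\<lambda>h. z * arrow_delta g h)"
    and add: "\<And>f h. \<lbrakk>f \<in> carrier CG; h \<in> carrier CG; P f; P h\<rbrakk> \<Longrightarrow> P (\<lambda>g. f g + h g)"
    and zero: "P (\<lambda>_. 0)"
  shows "P f"
proof -
  have "\<lbrakk>{g. f g \<noteq> 0} \<subseteq> S; S \<subseteq> arrows G\<rbrakk> \<Longrightarrow> P f" if "finite S" for S
    using that
  proof (induction S arbitrary: f)
    case empty
    then have "f = (\<lambda>_. 0)" by auto
    then show ?case using zero by simp
  next
    case (insert g S)
    have eq: "f = (\<lambda>h. (f(g := 0)) h + f g * arrow_delta g h)"
      by (auto simp: arrow_delta_def)
    have sub: "{h. (f(g := 0)) h \<noteq> 0} \<subseteq> S" using insert by auto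
    then have "f(g := 0) \<in> carrier CG" using insert finite_subset[OF sub] by (auto simp: CG_carrier)
    moreover have "(\<lambda>h. f g * arrow_delta g h) \<in> carrier CG"
      using insert by (intro smult_carrier delta_carrier) auto
    moreover have "P (f(g := 0))" using insert sub by (intro insert.IH) auto
    moreover have "P (\<lambda>h. f g * arrow_delta g h)" using insert by (intro delta) auto
    ultimately show ?case by (subst eq) (rule add)
  qed
  then show ?thesis using assms(1) unfolding CG_carrier by blast
qed

lemma conv_addl: assumes "f \<in> carrier CG" "f' \<in> carrier CG" "h \<in> carrier CG"
  shows "conv (\<lambda>g. f g + f' g) h = (\<lambda>g. conv f h g + conv f' h g)"
proof
  fix k
  let ?S = "{g. f g \<noteq> 0} \<union> {g. f' g \<noteq> 0}" and ?T = "{g. h g \<noteq> 0}"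
  have fin: "finite ?S" "finite ?T" using assms by (auto simp: CG_carrier)
  have sub: "{g. f g + f' g \<noteq> 0} \<subseteq> ?S" by auto
  show "conv (\<lambda>g. f g + f' g) h k = conv f h k + conv f' h k"
    unfolding conv_sum[OF fin Un_upper1 order_refl] conv_sum[OF fin Un_upper2 order_refl]
      conv_sum[OF fin sub order_refl] sum.distrib[symmetric]
    by (intro sum.cong) (simp_all add: distrib_right)
qed

lemma conv_addr: assumes "f \<in> carrier CG" "f' \<in> carrier CG" "h \<in> carrier CG"
  shows "conv h (\<lambda>g. f g + f' g) = (\<lambda>g. conv h f g + conv h f' g)"
proof
  fix k
  let ?S = "{g. f g \<noteq> 0} \<union> {g. f' g \<noteq> 0}" and ?T = "{g. h g \<noteq> 0}"
  have fin: "finite ?S" "finite ?T" using assms by (auto simp: CG_carrier)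
  have sub: "{g. f g + f' g \<noteq> 0} \<subseteq> ?S" by auto
  show "conv h (\<lambda>g. f g + f' g) k = conv h f k + conv h f' k"
    unfolding conv_sum[OF fin(2,1) order_refl Un_upper1] conv_sum[OF fin(2,1) order_refl Un_upper2]
      conv_sum[OF fin(2,1) order_refl sub] sum.distrib[symmetric]
    by (intro sum.cong) (simp_all add: distrib_left)
qed

lemma conv_smultl: assumes "f \<in> carrier CG" "h \<in> carrier CG"
  shows "conv (\<lambda>g. z * f g) h = (\<lambda>g. z * conv f h g)"
proof
  fix k
  let ?S = "{g. f g \<noteq> 0}" and ?T = "{g. h g \<noteq> 0}"
  have fin: "finite ?S" "finite ?T" using assms by (auto simp: CG_carrier)
  have sub: "{g. z * f g \<noteq> 0} \<subseteq> ?S" by auto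
  show "conv (\<lambda>g. z * f g) h k = z * conv f h k"
    unfolding conv_sum[OF fin order_refl order_refl] conv_sum[OF fin sub order_refl] sum_distrib_left
    by (intro sum.cong) simp_all
qed

lemma conv_smultr: assumes "f \<in> carrier CG" "h \<in> carrier CG"
  shows "conv f (\<lambda>g. z * h g) = (\<lambda>g. z * conv f h g)"
proof
  fix k
  let ?S = "{g. f g \<noteq> 0}" and ?T = "{g. h g \<noteq> 0}"
  have fin: "finite ?S" "finite ?T" using assms by (auto simp: CG_carrier)
  have sub: "{g. z * h g \<noteq> 0} \<subseteq> ?T" by auto
  show "conv f (\<lambda>g. z * h g) k = z * conv f h k"
    unfolding conv_sum[OF fin order_refl order_refl] conv_sum[OF fin order_refl sub] sum_distrib_left
    by (intro sum.cong) simp_all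
qed

lemma conv_delta: "conv (arrow_delta a) (arrow_delta b) =
    (if gdom G a = gcod G b then arrow_delta (gmul G a b) else (\<lambda>_. 0))"
  by (rule ext, subst conv_sum[of "{a}" "{b}"]) (auto simp: arrow_delta_def)

lemma star_delta: assumes g: "g \<in> arrows G" shows "star CG (arrow_delta g) = arrow_delta (ginv G g)"
proof -
  have "h = ginv G g \<longleftrightarrow> h \<in> arrows G \<and> ginv G h = g" for h
    using g inv_inv inv_closed by metis
  then show ?thesis by (auto simp: CG_simps arrow_delta_def)
qed

lemma zero_carrier: "(\<lambda>_. 0) \<in> carrier CG" by (simp add: CG_carrier)

lemma conv_zero: "conv (\<lambda>_. 0) h = (\<lambda>_. 0)" "conv h (\<lambda>_. 0) = (\<lambda>_. 0)"
  by (auto simp: groupoid_algebra_def)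

lemmas CG_closed = conv_closed add_carrier smult_carrier star_carrier delta_carrier zero_carrier
lemmas conv_lin = conv_addl conv_addr conv_smultl conv_smultr conv_zero

lemma star_lin: "star CG (\<lambda>g. f g + h g) = (\<lambda>g. star CG f g + star CG h g)"
  "star CG (\<lambda>g. z * f g) = (\<lambda>g. cnj z * star CG f g)" "star CG (\<lambda>_. 0) = (\<lambda>_. 0)"
  by (auto simp: CG_simps)

lemma conv_assoc:
  assumes "f \<in> carrier CG" "h \<in> carrier CG" "l \<in> carrier CG"
  shows "conv (conv f h) l = conv f (conv h l)"
  using assms(1)
proof (induction f rule: CG_induct)
  case (delta z a)
  show ?case using assms(2)
  proof (induction h rule: CG_induct)
    case (delta y b)
    show ?case using assms(3)
    proof (induction l rule: CG_induct)
      case (delta x c)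
      show ?case using delta \<open>a \<in> arrows G\<close> \<open>b \<in> arrows G\<close>
        by (auto simp: conv_lin CG_closed conv_delta mul_assoc mul_closed dom_mul cod_mul)
    qed (use \<open>a \<in> arrows G\<close> \<open>b \<in> arrows G\<close> in \<open>auto simp: conv_lin CG_closed\<close>)
  qed (use \<open>a \<in> arrows G\<close> assms(3) in \<open>auto simp: conv_lin CG_closed\<close>)
qed (use assms in \<open>auto simp: conv_lin CG_closed\<close>)

lemma star_conv:
  assumes "f \<in> carrier CG" "h \<in> carrier CG"
  shows "star CG (conv f h) = conv (star CG h) (star CG f)"
  using assms(1)
proof (induction f rule: CG_induct)
  case (delta z a)
  show ?case using assms(2)
  proof (induction h rule: CG_induct)
    case (delta y b)
    show ?case using delta \<open>a \<in> arrows G\<close>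
      by (auto simp: conv_lin star_lin CG_closed conv_delta star_delta mul_closed inv_closed
          inv_gmul dom_inv cod_inv)
  qed (use \<open>a \<in> arrows G\<close> in \<open>auto simp: conv_lin star_lin CG_closed\<close>)
qed (use assms in \<open>auto simp: conv_lin star_lin CG_closed\<close>)

lemma star_algebra_CG: "star_algebra CG"
proof (rule star_algebra.intro)
  have ag: "abelian_group CG"
  proof (rule abelian_groupI)
    fix f assume "f \<in> carrier CG"
    then show "\<exists>h\<in>carrier CG. h \<oplus>\<^bsub>CG\<^esub> f = \<zero>\<^bsub>CG\<^esub>"
      by (intro bexI[of _ "\<lambda>g. (-1) * f g"] smult_carrier) (auto simp: CG_simps)
  qed (auto simp: CG_simps CG_closed algebra_simps)
  show "module complex_ring CG"
    by (rule moduleI[OF cring_complex_ring ag]) (auto simp: CG_simps CG_closed algebra_simps)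
  show "star CG (star CG f) = f" if "f \<in> carrier CG" for f
    using that by (intro ext) (auto simp: CG_simps CG_carrier inv_inv inv_closed)
  show "star CG (f \<otimes>\<^bsub>CG\<^esub> h) = star CG h \<otimes>\<^bsub>CG\<^esub> star CG f" if "f \<in> carrier CG" "h \<in> carrier CG" for f h
    using that by (rule star_conv)
  show "star CG f \<in> carrier CG" if "f \<in> carrier CG" for f
    using that by (rule star_carrier)
  show "star CG (f \<oplus>\<^bsub>CG\<^esub> h) = star CG f \<oplus>\<^bsub>CG\<^esub> star CG h" for f h
    by (auto simp: CG_simps)
  show "star CG (z \<odot>\<^bsub>CG\<^esub> f) = cnj z \<odot>\<^bsub>CG\<^esub> star CG f" for f z
    by (auto simp: CG_simps)
qed (simp_all add: CG_simps(1-3) conv_closed conv_assoc conv_lin)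

interpretation CG: star_algebra CG by (rule star_algebra_CG)

lemma delta_norm_le: assumes p: "cstar_seminorm CG p" and g: "g \<in> arrows G"
  shows "p (arrow_delta g) \<le> 1"
proof -
  interpret P: cstar_seminormed CG p
    using p by (simp add: cstar_seminormed_def cstar_seminormed_axioms_def star_algebra_CG)
  have "(p (arrow_delta (gdom G g)))\<^sup>2 = p (conv (arrow_delta (ginv G (gdom G g))) (arrow_delta (gdom G g)))"
    using P.p_cstar[of "arrow_delta (gdom G g)"] g by (simp add: delta_carrier dom_closed star_delta)
  also have "\<dots> = p (arrow_delta (gdom G g))"
    using g by (simp add: conv_delta dom_inv cod_inv dom_closed dom_dom cod_dom inv_mul)
  finally have "p (arrow_delta (gdom G g)) = 0 \<or> p (arrow_delta (gdom G g)) = 1"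
    by (simp add: power2_eq_square)
  moreover have "(p (arrow_delta g))\<^sup>2 = p (arrow_delta (gdom G g))"
    using P.p_cstar[of "arrow_delta g"] g by (simp add: delta_carrier star_delta conv_delta dom_inv inv_mul)
  ultimately have "(p (arrow_delta g))\<^sup>2 \<le> 1\<^sup>2" by auto
  then show ?thesis by (rule power2_le_imp_le) simp
qed

lemma seminorms_bdd: assumes f: "f \<in> carrier CG"
  shows "\<exists>B. \<forall>p. cstar_seminorm CG p \<longrightarrow> p f \<le> B"
  using f
proof (induction f rule: CG_induct)
  case (delta z g)
  have "p (\<lambda>h. z * arrow_delta g h) \<le> cmod z" if p: "cstar_seminorm CG p" for p
  proof -
    have "p (\<lambda>h. z * arrow_delta g h) = cmod z * p (arrow_delta g)"
      using p delta_carrier[OF delta] unfolding cstar_seminorm_def by (auto simp: CG_simps)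
    also have "\<dots> \<le> cmod z * 1"
      using delta_norm_le[OF p delta] by (intro mult_left_mono) auto
    finally show ?thesis by simp
  qed
  then show ?case by blast
next
  case (add f h)
  then obtain B D where "\<And>p. cstar_seminorm CG p \<Longrightarrow> p f \<le> B" "\<And>p. cstar_seminorm CG p \<Longrightarrow> p h \<le> D"
    by blast
  moreover have "p (\<lambda>g. f g + h g) \<le> p f + p h" if "cstar_seminorm CG p" for p
    using that add unfolding cstar_seminorm_def by (auto simp: CG_simps)
  ultimately show ?case by (intro exI[of _ "B + D"]) (meson add_mono order_trans)
next
  case zero
  have "p (\<lambda>_. 0) = 0" if "cstar_seminorm CG p" for p
  proof -
    have "p (0 \<odot>\<^bsub>CG\<^esub> (\<lambda>_. 0)) = cmod 0 * p (\<lambda>_. 0)"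
      using that zero_carrier unfolding cstar_seminorm_def by blast
    then show ?thesis by (simp add: CG_simps)
  qed
  then show ?case by (metis order_refl)
qed

lemma le_max_seminorm: assumes "cstar_seminorm CG p" "f \<in> carrier CG" shows "p f \<le> max_seminorm CG f"
proof -
  obtain B where "\<And>q. cstar_seminorm CG q \<Longrightarrow> q f \<le> B" using seminorms_bdd[OF assms(2)] by blast
  then show ?thesis
    unfolding max_seminorm_def using assms(1) by (intro cSup_upper bdd_aboveI[of _ B]) auto
qed

lemma zero_seminorm: "cstar_seminorm CG (\<lambda>_. 0)"
  by (simp add: cstar_seminorm_def)

lemma max_seminorm_le: "(\<And>p. cstar_seminorm CG p \<Longrightarrow> p f \<le> B) \<Longrightarrow> max_seminorm CG f \<le> B"
  unfolding max_seminorm_def using zero_seminorm by (intro cSup_least) auto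

lemma cstar_seminorm_max: "cstar_seminorm CG (max_seminorm CG)"
proof -
  let ?N = "max_seminorm CG"
  have le: "p f \<le> ?N f" if "cstar_seminorm CG p" "f \<in> carrier CG" for p f
    using le_max_seminorm that by blast
  have nn: "0 \<le> ?N f" if "f \<in> carrier CG" for f using le[OF zero_seminorm that] .
  show ?thesis
    unfolding cstar_seminorm_def
  proof (intro conjI ballI allI)
    fix f assume f: "f \<in> carrier CG"
    show "0 \<le> ?N f" using nn f .
    have scal: "?N (z \<odot>\<^bsub>CG\<^esub> f) \<le> cmod z * ?N f" if f: "f \<in> carrier CG" for z f
    proof (rule max_seminorm_le)
      fix p assume p: "cstar_seminorm CG p"
      then have "p (z \<odot>\<^bsub>CG\<^esub> f) = cmod z * p f" using f by (simp add: cstar_seminorm_def)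
      then show "p (z \<odot>\<^bsub>CG\<^esub> f) \<le> cmod z * ?N f" using le[OF p f] by (simp add: mult_left_mono)
    qed
    show "?N (z \<odot>\<^bsub>CG\<^esub> f) = cmod z * ?N f" for z
    proof (cases "z = 0")
      case True
      then show ?thesis using scal[OF f, of z] nn[of "z \<odot>\<^bsub>CG\<^esub> f"] f by simp
    next
      case False
      have "f = (1 / z) \<odot>\<^bsub>CG\<^esub> (z \<odot>\<^bsub>CG\<^esub> f)" using False by (simp add: CG_simps)
      then have "?N f \<le> cmod (1 / z) * ?N (z \<odot>\<^bsub>CG\<^esub> f)"
        using scal[of "z \<odot>\<^bsub>CG\<^esub> f" "1 / z"] f by simp
      then have "cmod z * ?N f \<le> ?N (z \<odot>\<^bsub>CG\<^esub> f)"
        using False by (simp add: norm_divide field_simps)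
      then show ?thesis using scal[OF f, of z] by simp
    qed
    show "?N (star CG f \<otimes>\<^bsub>CG\<^esub> f) = (?N f)\<^sup>2"
    proof (rule antisym)
      show "?N (star CG f \<otimes>\<^bsub>CG\<^esub> f) \<le> (?N f)\<^sup>2"
      proof (rule max_seminorm_le)
        fix p assume p: "cstar_seminorm CG p"
        then have "p (star CG f \<otimes>\<^bsub>CG\<^esub> f) = (p f)\<^sup>2" "0 \<le> p f" using f by (auto simp: cstar_seminorm_def)
        then show "p (star CG f \<otimes>\<^bsub>CG\<^esub> f) \<le> (?N f)\<^sup>2" using le[OF p f] by (simp add: power_mono)
      qed
      have c: "star CG f \<otimes>\<^bsub>CG\<^esub> f \<in> carrier CG" using f by (simp add: CG_closed)
      have "?N f \<le> sqrt (?N (star CG f \<otimes>\<^bsub>CG\<^esub> f))"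
      proof (rule max_seminorm_le)
        fix p assume p: "cstar_seminorm CG p"
        then have "(p f)\<^sup>2 = p (star CG f \<otimes>\<^bsub>CG\<^esub> f)" using f by (auto simp: cstar_seminorm_def)
        then show "p f \<le> sqrt (?N (star CG f \<otimes>\<^bsub>CG\<^esub> f))"
          using le[OF p c] by (simp add: real_le_rsqrt)
      qed
      then show "(?N f)\<^sup>2 \<le> ?N (star CG f \<otimes>\<^bsub>CG\<^esub> f)"
        using nn[OF f] nn[OF c] by (metis power_mono real_sqrt_pow2)
    qed
    fix h assume h: "h \<in> carrier CG"
    show "?N (f \<oplus>\<^bsub>CG\<^esub> h) \<le> ?N f + ?N h"
    proof (rule max_seminorm_le)
      fix p assume p: "cstar_seminorm CG p"
      then have "p (f \<oplus>\<^bsub>CG\<^esub> h) \<le> p f + p h" using f h by (simp add: cstar_seminorm_def)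
      then show "p (f \<oplus>\<^bsub>CG\<^esub> h) \<le> ?N f + ?N h" using le[OF p f] le[OF p h] by linarith
    qed
    show "?N (f \<otimes>\<^bsub>CG\<^esub> h) \<le> ?N f * ?N h"
    proof (rule max_seminorm_le)
      fix p assume p: "cstar_seminorm CG p"
      then have "p (f \<otimes>\<^bsub>CG\<^esub> h) \<le> p f * p h" "0 \<le> p f" "0 \<le> p h"
        using f h by (auto simp: cstar_seminorm_def)
      moreover have "p f * p h \<le> ?N f * ?N h"
        using le[OF p f] le[OF p h] calculation nn[OF f] by (intro mult_mono) auto
      ultimately show "p (f \<otimes>\<^bsub>CG\<^esub> h) \<le> ?N f * ?N h" by linarith
    qed
  qed
qed

lemma CG_seminormed: "cstar_seminormed CG (max_seminorm CG)"
  by (simp add: cstar_seminormed_def cstar_seminormed_axioms_def star_algebra_CG cstar_seminorm_max)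

theorem cstar_algebra_groupoid_cstar: "cstar_algebra (groupoid_cstar G)"
  unfolding groupoid_cstar_def enveloping_cstar_def
  by (rule cstar_seminormed.cstar_algebra_completion[OF CG_seminormed])

theorem unitary_rep_canonical: "unitary_rep G (groupoid_cstar G) (canonical_rep G)"
proof -
  interpret P: cstar_seminormed CG "max_seminorm CG" by (rule CG_seminormed)
  have u: "arrow_delta v \<in> carrier CG \<and> gcod G v = v \<and> ginv G v = v \<and> gmul G v v = v"
    if "v \<in> units G" for v
  proof -
    have v: "v \<in> arrows G" "gdom G v = v" "gcod G v = v"
      using that cod_dom[of v] by (auto simp: units_def)
    then have "gmul G v v = v" using mul_dom[of v] by simp
    then show ?thesis using v inv_unique[of v v] delta_carrier by simp
  qed
  have z: "\<zero>\<^bsub>CG\<^esub> = (\<lambda>_. 0)" by (simp add: CG_simps)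
  show ?thesis
    unfolding unitary_rep_def groupoid_cstar_def enveloping_cstar_def canonical_rep_def env_embed_def
    by (auto simp: P.cl_simps P.C_intros delta_carrier star_carrier star_delta conv_delta inv_closed
        dom_inv cod_inv inv_mul mul_inv CG_closed z u units_def P.cl_carrier zero_carrier
        simp del: Image_singleton_iff)
qed

text \<open>
  The image of the convolution algebra, i.e. the linear span of the canonical representation, is
  dense, and every unitary representation in a C*-algebra of any type extends to a contractive
  *-homomorphism (necessarily unique): the universal property of the full groupoid C*-algebra.
\<close>

theorem canonical_dense: assumes "X \<in> carrier (groupoid_cstar G)" "e > 0"
  shows "\<exists>f\<in>carrier CG. cnorm (groupoid_cstar G) (X \<ominus>\<^bsub>groupoid_cstar G\<^esub> env_embed CG f) \<le> e"
  using cstar_seminormed.emb_dense[OF CG_seminormed] assms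
  unfolding groupoid_cstar_def enveloping_cstar_def env_embed_def by blast

theorem groupoid_cstar_universal:
  fixes B :: "('b, 'n) normed_star_alg_scheme"
  assumes B: "cstar_algebra B" and U: "unitary_rep G B U"
  shows "\<exists>F. star_hom (groupoid_cstar G) B F \<and>
    (\<forall>X\<in>carrier (groupoid_cstar G). cnorm B (F X) \<le> cnorm (groupoid_cstar G) X) \<and>
    (\<forall>g\<in>arrows G. F (canonical_rep G g) = U g)"
proof -
  interpret B: cstar_algebra B by (rule B)
  interpret Bn: cstar_seminormed B "cnorm B" by (rule B.cstar_seminormed)
  have Uc: "U g \<in> carrier B" if "g \<in> arrows G" for g using U that by (auto simp: unitary_rep_def)
  have Umul: "U g \<otimes>\<^bsub>B\<^esub> U h = (if gdom G g = gcod G h then U (gmul G g h) else \<zero>\<^bsub>B\<^esub>)"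
    if "g \<in> arrows G" "h \<in> arrows G" for g h using U that by (auto simp: unitary_rep_def)
  have Uini: "star B (U g) \<otimes>\<^bsub>B\<^esub> U g = U (gdom G g)" "U g \<otimes>\<^bsub>B\<^esub> star B (U g) = U (gcod G g)"
    if "g \<in> arrows G" for g using U that by (auto simp: unitary_rep_def)
  have Ustar: "star B (U g) = U (ginv G g)" if g: "g \<in> arrows G" for g
  proof -
    have "star B (U g) = star B (U g \<otimes>\<^bsub>B\<^esub> U (gdom G g))"
      using g by (simp add: Umul dom_closed cod_dom mul_dom)
    also have "\<dots> = star B (U g \<otimes>\<^bsub>B\<^esub> (star B (U g) \<otimes>\<^bsub>B\<^esub> U g))"
      using g by (simp add: Uini)
    also have "\<dots> = star B (U g) \<otimes>\<^bsub>B\<^esub> U g \<otimes>\<^bsub>B\<^esub> star B (U g)"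
      using g Uc[OF g] by (simp add: B.star_mult B.star_star B.star_closed B.mult_closed)
    also have "\<dots> = U (gdom G g) \<otimes>\<^bsub>B\<^esub> star B (U g)"
      using g by (simp add: Uini)
    also have "\<dots> = U (ginv G g) \<otimes>\<^bsub>B\<^esub> U g \<otimes>\<^bsub>B\<^esub> star B (U g)"
      using g by (simp add: Umul inv_closed dom_inv inv_mul)
    also have "\<dots> = U (ginv G g) \<otimes>\<^bsub>B\<^esub> U (gcod G g)"
      using g Uc by (simp add: B.mult_assoc Uini inv_closed B.star_closed)
    also have "\<dots> = U (ginv G g)"
      using g mul_dom[of "ginv G g"] by (simp add: Umul inv_closed dom_inv cod_closed cod_cod)
    finally show ?thesis .
  qed
  define f where "f = (\<lambda>a. finsum B (\<lambda>g. a g \<odot>\<^bsub>B\<^esub> U g) {g. a g \<noteq> 0})"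
  have f_eq: "f a = finsum B (\<lambda>g. a g \<odot>\<^bsub>B\<^esub> U g) S"
    if "finite S" "{g. a g \<noteq> 0} \<subseteq> S" "S \<subseteq> arrows G" for a S
    unfolding f_def
    by (rule B.add.finprod_mono_neutral_cong_left)
      (use that Uc B.smult_zero_l in \<open>auto simp: subset_iff\<close>)
  have fc: "f a \<in> carrier B" if "a \<in> carrier CG" for a
    unfolding f_def using that Uc by (intro B.finsum_closed) (auto simp: CG_carrier)
  have f_add: "f (\<lambda>g. a g + b g) = f a \<oplus>\<^bsub>B\<^esub> f b" if "a \<in> carrier CG" "b \<in> carrier CG" for a b
  proof -
    let ?S = "{g. a g \<noteq> 0} \<union> {g. b g \<noteq> 0}"
    have S: "finite ?S" "?S \<subseteq> arrows G" using that by (auto simp: CG_carrier)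
    then have US: "U \<in> ?S \<rightarrow> carrier B" using Uc by auto
    have "f (\<lambda>g. a g + b g) = finsum B (\<lambda>g. (a g + b g) \<odot>\<^bsub>B\<^esub> U g) ?S"
      using S by (intro f_eq) auto
    also have "\<dots> = finsum B (\<lambda>g. a g \<odot>\<^bsub>B\<^esub> U g \<oplus>\<^bsub>B\<^esub> b g \<odot>\<^bsub>B\<^esub> U g) ?S"
      using S Uc by (intro B.finsum_cong') (auto simp: subset_iff B.csmult_distr)
    also have "\<dots> = finsum B (\<lambda>g. a g \<odot>\<^bsub>B\<^esub> U g) ?S \<oplus>\<^bsub>B\<^esub> finsum B (\<lambda>g. b g \<odot>\<^bsub>B\<^esub> U g) ?S"
      using US by (intro B.finsum_addf) auto
    also have "\<dots> = f a \<oplus>\<^bsub>B\<^esub> f b" using f_eq[OF S(1) _ S(2), of a] f_eq[OF S(1) _ S(2), of b] by auto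
    finally show ?thesis .
  qed
  have f_smult: "f (\<lambda>g. z * a g) = z \<odot>\<^bsub>B\<^esub> f a" if "a \<in> carrier CG" for z a
  proof -
    let ?S = "{g. a g \<noteq> 0}"
    have S: "finite ?S" "?S \<subseteq> arrows G" using that by (auto simp: CG_carrier)
    then have US: "U \<in> ?S \<rightarrow> carrier B" using Uc by auto
    have "f (\<lambda>g. z * a g) = finsum B (\<lambda>g. (z * a g) \<odot>\<^bsub>B\<^esub> U g) ?S"
      using S by (intro f_eq) auto
    also have "\<dots> = finsum B (\<lambda>g. z \<odot>\<^bsub>B\<^esub> (a g \<odot>\<^bsub>B\<^esub> U g)) ?S"
      using S Uc by (intro B.finsum_cong') (auto simp: subset_iff B.csmult_assoc)
    also have "\<dots> = z \<odot>\<^bsub>B\<^esub> f a"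
      unfolding f_def using S US by (intro B.finsum_smult_ldistr[symmetric]) auto
    finally show ?thesis .
  qed
  have f_delta: "f (arrow_delta g) = U g" if "g \<in> arrows G" for g
    using f_eq[of "{g}" "arrow_delta g"] Uc[OF that] that B.smult_one
    by (simp add: arrow_delta_def)
  have f_zero: "f (\<lambda>_. 0) = \<zero>\<^bsub>B\<^esub>" by (simp add: f_def)
  have f_mult: "f (conv a b) = f a \<otimes>\<^bsub>B\<^esub> f b" if ab: "a \<in> carrier CG" "b \<in> carrier CG" for a b
    using ab(1)
  proof (induction a rule: CG_induct)
    case (delta z g)
    show ?case using ab(2)
    proof (induction b rule: CG_induct)
      case (delta y h)
      show ?case using delta \<open>g \<in> arrows G\<close>
        by (simp add: conv_lin CG_closed conv_delta f_smult f_delta f_zero Umul mul_closed Uc fc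
            B.mult_smultl B.mult_smultr B.csmult_assoc[symmetric] mult.commute)
    next
      case (add b c)
      then show ?case using \<open>g \<in> arrows G\<close> by (simp add: conv_lin CG_closed f_add B.mult_distr fc)
    next
      case zero
      have "f (\<lambda>h. z * arrow_delta g h) \<otimes>\<^bsub>B\<^esub> (0 \<odot>\<^bsub>B\<^esub> \<zero>\<^bsub>B\<^esub>) = \<zero>\<^bsub>B\<^esub>"
        using fc \<open>g \<in> arrows G\<close>
        by (subst B.mult_smultr) (auto simp: CG_closed B.smult_zero_l B.mult_closed)
      then show ?case using B.smult_zero_l[of "\<zero>\<^bsub>B\<^esub>"] by (simp add: conv_lin f_zero)
    qed
  next
    case (add a c)
    then show ?case using ab by (simp add: conv_lin CG_closed f_add B.mult_distl fc)
  next
    case zero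
    have "(0 \<odot>\<^bsub>B\<^esub> \<zero>\<^bsub>B\<^esub>) \<otimes>\<^bsub>B\<^esub> f b = \<zero>\<^bsub>B\<^esub>"
      using fc ab by (subst B.mult_smultl) (auto simp: B.smult_zero_l B.mult_closed)
    then show ?case using B.smult_zero_l[of "\<zero>\<^bsub>B\<^esub>"] by (simp add: conv_lin f_zero)
  qed
  have f_star: "f (star CG a) = star B (f a)" if a: "a \<in> carrier CG" for a
    using a
  proof (induction a rule: CG_induct)
    case zero
    have "star B (0 \<odot>\<^bsub>B\<^esub> \<zero>\<^bsub>B\<^esub>) = \<zero>\<^bsub>B\<^esub>"
      by (subst B.star_smult) (auto simp: B.smult_zero_l B.star_closed)
    then show ?case using B.smult_zero_l[of "\<zero>\<^bsub>B\<^esub>"] by (simp add: star_lin f_zero)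
  qed (auto simp: star_lin CG_closed f_add f_smult f_delta fc star_delta inv_closed Ustar Uc
        B.star_add B.star_smult)
  have hom: "star_hom CG B f"
    unfolding star_hom_def using fc f_add f_smult f_mult f_star by (auto simp: CG_simps(1-3))
  have sn: "cstar_seminorm CG (\<lambda>a. cnorm B (f a))"
    unfolding cstar_seminorm_def
    using fc Bn.p_nonneg Bn.p_add Bn.p_smult Bn.p_mult Bn.p_cstar
    by (auto simp: CG_simps(1-3) f_add f_smult f_mult f_star CG_closed)
  have bd: "cnorm B (f a) \<le> max_seminorm CG a" if "a \<in> carrier CG" for a
    using le_max_seminorm[OF sn that] .
  from cstar_seminormed.completion_extend[OF CG_seminormed B hom bd]
  obtain F where "star_hom (completion CG (max_seminorm CG)) B F"
    "\<forall>X\<in>carrier (completion CG (max_seminorm CG)). cnorm B (F X) \<le> cnorm (completion CG (max_seminorm CG)) X"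
    "\<forall>a\<in>carrier CG. F (null_rel CG (max_seminorm CG) `` {\<lambda>_. a}) = f a"
    by blast
  then show ?thesis
    unfolding groupoid_cstar_def enveloping_cstar_def canonical_rep_def env_embed_def
    using f_delta delta_carrier by (intro exI[of _ F]) auto
qed

lemma group_isotropy: assumes "x \<in> units G" shows "group (isotropy_group G x)"
proof -
  have x: "x \<in> arrows G" "gdom G x = x" "gcod G x = x"
    using assms cod_dom[of x] by (auto simp: units_def)
  show ?thesis
  proof (rule groupI)
    fix g assume g: "g \<in> carrier (isotropy_group G x)"
    then show "\<one>\<^bsub>isotropy_group G x\<^esub> \<otimes>\<^bsub>isotropy_group G x\<^esub> g = g"
      using cod_mul_self[of g] by (auto simp: isotropy_group_def)
    show "\<exists>h\<in>carrier (isotropy_group G x). h \<otimes>\<^bsub>isotropy_group G x\<^esub> g = \<one>\<^bsub>isotropy_group G x\<^esub>"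
      using g by (intro bexI[of _ "ginv G g"])
        (auto simp: isotropy_group_def inv_mul inv_closed dom_inv cod_inv)
  qed (use x in \<open>auto simp: isotropy_group_def mul_closed dom_mul cod_mul mul_assoc\<close>)
qed

lemma equiv_orbit_rel: "equiv (units G) (orbit_rel G)"
proof (rule equivI)
  show "orbit_rel G \<subseteq> units G \<times> units G" by (auto simp: orbit_rel_def)
  have "v \<in> arrows G \<and> gdom G v = v \<and> gcod G v = v" if "v \<in> units G" for v
    using that cod_dom[of v] by (auto simp: units_def)
  then show "refl_on (units G) (orbit_rel G)" unfolding refl_on_def orbit_rel_def by blast
  show "sym (orbit_rel G)"
    unfolding sym_def orbit_rel_def using inv_closed dom_inv cod_inv by fastforce
  show "trans (orbit_rel G)"
  proof (rule transI)
    fix x y z assume "(x, y) \<in> orbit_rel G" "(y, z) \<in> orbit_rel G"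
    then obtain g h where "x \<in> units G" "z \<in> units G" "g \<in> arrows G" "h \<in> arrows G"
      "gdom G g = x" "gcod G g = gdom G h" "gcod G h = z" by (auto simp: orbit_rel_def)
    then show "(x, z) \<in> orbit_rel G"
      unfolding orbit_rel_def using mul_closed[of h g] dom_mul[of h g] cod_mul[of h g] by auto
  qed
qed

end

lemma groupoid_group_groupoid: assumes "group H" shows "groupoid (group_groupoid H)"
proof -
  interpret group H by (rule assms)
  show ?thesis by unfold_locales (auto simp: group_groupoid_def m_assoc)
qed

end

(* Extending a trace: a positive trace t on the convolution algebra makes each arrow act by a partial
   isometry in the semi-inner product t (a^* b), so the operator norm of left multiplication is a
   C*-seminorm. As there are finitely many units the algebra is unital, and Cauchy-Schwarz against the
   unit bounds t by this seminorm, hence by the maximal one; so t extends to the completion. For the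
   induced trace, t is the sum over y in C of the given group trace applied to the diagonal block (y, y)
   of the matrix that the arrows k y turn an element of the convolution algebra into.

   Decomposing a trace: the indicator function of a class C is a central projection P_C, and these sum
   to the unit, so sigma is the sum of the traces sigma (P_C a), without any appeal to continuity of
   sigma. Conjugating by k y, such a trace is determined on arrows by its values on the isotropy group,
   which are those of sigma pulled back along the *-homomorphism given by the universal property. *)

theory Submission
  imports Defs
begin

section \<open>Positive functionals on *-algebras\<close>

text \<open>The seminorm of the semi-inner product \<open>t (star A a \<otimes> b)\<close>. For
  positive \<open>t\<close> the argument of \<open>Re\<close> is already a nonnegative real.\<close>

definition functional_norm :: "('a, 'm) star_alg_scheme \<Rightarrow> ('a \<Rightarrow> complex) \<Rightarrow> 'a \<Rightarrow> real" where
  "functional_norm A t a = sqrt (Re (t (star A a \<otimes>\<^bsub>A\<^esub> a)))"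

locale positive_functional = star_algebra A for A :: "('a, 'm) star_alg_scheme" (structure) +
  fixes t :: "'a \<Rightarrow> complex"
  assumes t_add: "\<lbrakk>a \<in> carrier A; b \<in> carrier A\<rbrakk> \<Longrightarrow> t (a \<oplus> b) = t a + t b"
    and t_smult: "a \<in> carrier A \<Longrightarrow> t (z \<odot> a) = z * t a"
    and t_pos: "a \<in> carrier A \<Longrightarrow> t (star A a \<otimes> a) \<in> \<real>\<^sub>\<ge>\<^sub>0"
begin

abbreviation q where "q \<equiv> functional_norm A t"

lemma q_nonneg: "a \<in> carrier A \<Longrightarrow> 0 \<le> q a"
  using t_pos[of a] by (auto simp: functional_norm_def complex_nonneg_Reals_iff)

lemma t_star_self: "a \<in> carrier A \<Longrightarrow> t (star A a \<otimes> a) = complex_of_real ((q a)\<^sup>2)"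
  using t_pos[of a]
  by (auto simp: functional_norm_def complex_nonneg_Reals_iff complex_eq_iff)

text \<open>The quadratic form along the line from \<open>a\<close> in direction \<open>b\<close>.
  Hermitian symmetry, Cauchy-Schwarz and the triangle inequality all follow by choosing
  \<open>z\<close>.\<close>

lemma t_expand:
  assumes "a \<in> carrier A" "b \<in> carrier A"
  shows "complex_of_real ((q (a \<oplus> z \<odot> b))\<^sup>2) =
    (q a)\<^sup>2 + z * t (star A a \<otimes> b) + cnj z * t (star A b \<otimes> a) + z * cnj z * (q b)\<^sup>2"
proof -
  have "star A (a \<oplus> z \<odot> b) \<otimes> (a \<oplus> z \<odot> b) =
      (star A a \<otimes> a \<oplus> z \<odot> (star A a \<otimes> b)) \<oplus>
      (cnj z \<odot> (star A b \<otimes> a) \<oplus> z \<odot> (cnj z \<odot> (star A b \<otimes> b)))"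
    using assms
    by (simp add: star_add star_smult smult_r_distr mult_distl mult_distr mult_smultl mult_smultr star_closed
        mult_closed a_ac)
  then show ?thesis
    using assms t_star_self[of "a \<oplus> z \<odot> b"]
    by (simp add: t_add t_smult mult_closed star_closed t_star_self algebra_simps)
qed

text \<open>The left side of \<open>t_expand\<close> is real, so vanishing imaginary parts at
  \<open>z = 1\<close> and \<open>z = \<i>\<close> give one real equation for each
  component.\<close>

lemma t_hermitian:
  assumes "a \<in> carrier A" "b \<in> carrier A"
  shows "t (star A b \<otimes> a) = cnj (t (star A a \<otimes> b))"
proof -
  have "Im (t (star A a \<otimes> b) + t (star A b \<otimes> a)) = 0"
    using arg_cong[OF t_expand[OF assms, of 1], of Im] by simp
  moreover have "Re (t (star A a \<otimes> b)) = Re (t (star A b \<otimes> a))"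
    using arg_cong[OF t_expand[OF assms, of \<i>], of Im] by simp
  ultimately show ?thesis by (auto simp: complex_eq_iff)
qed

lemma t_cauchy_schwarz:
  assumes ab: "a \<in> carrier A" "b \<in> carrier A"
  shows "cmod (t (star A a \<otimes> b)) \<le> q a * q b"
proof -
  define w where "w = t (star A a \<otimes> b)"
  \<comment> \<open>Take \<open>z = - s * cnj w\<close> in \<open>t_expand\<close>: the phase of
    \<open>w\<close> cancels, and a real quadratic in \<open>s\<close> remains that is never
    negative.\<close>
  have key: "0 \<le> (q a)\<^sup>2 - 2 * s * (cmod w)\<^sup>2 + s\<^sup>2 * (cmod w)\<^sup>2 * (q b)\<^sup>2" for s :: real
  proof -
    let ?z = "- (of_real s * cnj w)"
    have "complex_of_real ((q (a \<oplus> ?z \<odot> b))\<^sup>2) =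
        (q a)\<^sup>2 - 2 * s * (w * cnj w) + s\<^sup>2 * (w * cnj w) * (q b)\<^sup>2"
      using t_expand[OF ab, of ?z] t_hermitian[OF ab]
      by (simp add: w_def[symmetric] power2_eq_square algebra_simps)
    also have "\<dots> = complex_of_real ((q a)\<^sup>2 - 2 * s * (cmod w)\<^sup>2 + s\<^sup>2 * (cmod w)\<^sup>2 * (q b)\<^sup>2)"
      by (simp add: complex_norm_square[symmetric])
    finally have "(q (a \<oplus> ?z \<odot> b))\<^sup>2 = (q a)\<^sup>2 - 2 * s * (cmod w)\<^sup>2 + s\<^sup>2 * (cmod w)\<^sup>2 * (q b)\<^sup>2"
      by (simp only: of_real_eq_iff)
    then show ?thesis using zero_le_power2[of "q (a \<oplus> ?z \<odot> b)"] by linarith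
  qed
  have "(cmod w)\<^sup>2 \<le> (q a)\<^sup>2 * (q b)\<^sup>2"
  proof (cases "q b = 0")
    case True
    have "(cmod w)\<^sup>2 = 0"
    proof (rule ccontr)
      assume "(cmod w)\<^sup>2 \<noteq> 0"
      moreover from this have "0 \<le> (q a)\<^sup>2 - 2 * ((q a)\<^sup>2 + 1)"
        \<comment> \<open>With \<open>q b = 0\<close> the quadratic is linear in \<open>s\<close>,
          and this \<open>s\<close> would make it negative.\<close>
        using key[of "((q a)\<^sup>2 + 1) / (cmod w)\<^sup>2"] True by simp
      ultimately show False using zero_le_power2[of "q a"] by (simp add: algebra_simps)
    qed
    then show ?thesis using True by simp
  next
    case False
    then have "0 \<le> (q a)\<^sup>2 - (cmod w)\<^sup>2 / (q b)\<^sup>2"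
      \<comment> \<open>This \<open>s\<close> minimises the quadratic.\<close>
      using key[of "1 / (q b)\<^sup>2"] by (simp add: power2_eq_square)
    moreover have "(q b)\<^sup>2 > 0" using False by simp
    ultimately show ?thesis by (simp add: pos_divide_le_eq)
  qed
  then have "(cmod w)\<^sup>2 \<le> (q a * q b)\<^sup>2" by (simp add: power_mult_distrib)
  then show ?thesis
    unfolding w_def using q_nonneg ab by - (rule power2_le_imp_le, auto)
qed

lemma q_add: assumes "a \<in> carrier A" "b \<in> carrier A" shows "q (a \<oplus> b) \<le> q a + q b"
proof -
  have "(q (a \<oplus> b))\<^sup>2 = (q a)\<^sup>2 + 2 * Re (t (star A a \<otimes> b)) + (q b)\<^sup>2"
    using arg_cong[OF t_expand[OF assms, of 1], of Re] t_hermitian[OF assms] assms smult_one[of b]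
    by simp
  also have "\<dots> \<le> (q a)\<^sup>2 + 2 * (q a * q b) + (q b)\<^sup>2"
    using complex_Re_le_cmod[of "t (star A a \<otimes> b)"] t_cauchy_schwarz[OF assms] by linarith
  also have "\<dots> = (q a + q b)\<^sup>2" by (simp add: power2_sum)
  finally show ?thesis using q_nonneg assms by - (rule power2_le_imp_le, auto)
qed

lemma q_smult: assumes a: "a \<in> carrier A" shows "q (z \<odot> a) = cmod z * q a"
proof -
  have "star A (z \<odot> a) \<otimes> (z \<odot> a) = (z * cnj z) \<odot> (star A a \<otimes> a)"
    using a by (simp add: star_smult mult_smultl mult_smultr star_closed mult_closed csmult_assoc)
  then have "complex_of_real ((q (z \<odot> a))\<^sup>2) = of_real ((cmod z * q a)\<^sup>2)"
    using a t_star_self[of "z \<odot> a"]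
    by (simp add: t_smult mult_closed star_closed t_star_self complex_norm_square[symmetric]
        power_mult_distrib)
  then have "(q (z \<odot> a))\<^sup>2 = (cmod z * q a)\<^sup>2" by (simp only: of_real_eq_iff)
  then show ?thesis using q_nonneg a by - (rule power2_eq_imp_eq, auto)
qed

text \<open>Cauchy-Schwarz for \<open>h\<close> and
  \<open>star A a \<otimes> (a \<otimes> h)\<close>, whose inner product is that of
  \<open>a \<otimes> h\<close> with itself. Both the bound for adjoints and the hard half of the
  C*-identity rest on it.\<close>

lemma q_adjoint:
  assumes "a \<in> carrier A" "h \<in> carrier A"
  shows "(q (a \<otimes> h))\<^sup>2 \<le> q h * q (star A a \<otimes> (a \<otimes> h))"
proof -
  have "(q (a \<otimes> h))\<^sup>2 = cmod (t (star A h \<otimes> (star A a \<otimes> (a \<otimes> h))))"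
    using assms t_star_self[of "a \<otimes> h"]
    by (metis abs_power2 mult_assoc mult_closed norm_of_real star_closed star_mult)
  also have "\<dots> \<le> q h * q (star A a \<otimes> (a \<otimes> h))"
    using assms by (intro t_cauchy_schwarz) (auto simp: mult_closed star_closed)
  finally show ?thesis .
qed

end

section \<open>The operator norm of left multiplication as a C*-seminorm\<close>

definition gns_norm :: "('a, 'm) star_alg_scheme \<Rightarrow> ('a \<Rightarrow> complex) \<Rightarrow> 'a \<Rightarrow> real" where
  "gns_norm A t a =
     Inf {c. 0 \<le> c \<and> (\<forall>h\<in>carrier A. functional_norm A t (a \<otimes>\<^bsub>A\<^esub> h) \<le> c * functional_norm A t h)}"

text \<open>Boundedness keeps the set in \<open>gns_norm\<close> nonempty, so that its infimum is
  itself a bound. Null vectors of \<open>q\<close> are not divided out: everything is computed on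
  the algebra, without a Hilbert space.\<close>

locale bounded_positive_functional = positive_functional +
  assumes bounded: "a \<in> carrier A \<Longrightarrow>
    \<exists>c\<ge>0. \<forall>h\<in>carrier A. functional_norm A t (a \<otimes> h) \<le> c * functional_norm A t h"
begin

abbreviation p where "p \<equiv> gns_norm A t"

lemma p_nonneg: "a \<in> carrier A \<Longrightarrow> 0 \<le> p a"
  unfolding gns_norm_def using bounded[of a] by (intro cInf_greatest) auto

lemma q_le: assumes "a \<in> carrier A" "h \<in> carrier A" shows "q (a \<otimes> h) \<le> p a * q h"
proof (cases "q h = 0")
  case True
  then show ?thesis using bounded[OF assms(1)] assms by auto
next
  case False
  then have pos: "q h > 0" using q_nonneg[OF assms(2)] by simp
  have "q (a \<otimes> h) / q h \<le> p a"
    unfolding gns_norm_def using bounded[OF assms(1)] assms pos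
    by (intro cInf_greatest) (auto simp: field_simps)
  then show ?thesis using pos by (simp add: field_simps)
qed

lemma p_le: "\<lbrakk>0 \<le> c; \<And>h. h \<in> carrier A \<Longrightarrow> q (a \<otimes> h) \<le> c * q h\<rbrakk> \<Longrightarrow> p a \<le> c"
  unfolding gns_norm_def by (intro cInf_lower) auto

text \<open>By \<open>q_adjoint\<close> for the adjoint, the square of \<open>?r\<close> is at most
  \<open>q h * p a * ?r\<close>; cancelling one factor \<open>?r\<close> gives the bound.\<close>

lemma p_star_le: assumes a: "a \<in> carrier A" shows "p (star A a) \<le> p a"
proof (rule p_le[OF p_nonneg[OF a]])
  fix h assume h: "h \<in> carrier A"
  let ?r = "q (star A a \<otimes> h)"
  have ah: "star A a \<otimes> h \<in> carrier A" using a h by (simp add: star_closed mult_closed)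
  have "?r\<^sup>2 \<le> q h * (p a * ?r)"
    using q_adjoint[of "star A a" h] a h q_le[OF a ah] q_nonneg[OF h]
    by (simp add: star_closed star_star) (meson mult_left_mono order_trans)
  then have "?r * ?r \<le> (p a * q h) * ?r" by (simp add: power2_eq_square algebra_simps)
  moreover have "0 \<le> p a * q h" using p_nonneg q_nonneg a h by simp
  ultimately show "?r \<le> p a * q h" by (cases "?r = 0") (use q_nonneg[OF ah] in auto)
qed

lemma cstar_seminorm_gns: "cstar_seminorm A p"
  unfolding cstar_seminorm_def
proof (intro conjI ballI allI)
  fix a assume a: "a \<in> carrier A"
  show "0 \<le> p a" using a by (rule p_nonneg)
  have le: "p (z \<odot> b) \<le> cmod z * p b" if "b \<in> carrier A" for z b
    using that p_nonneg[of b] q_le[of b]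
    by (intro p_le) (auto simp: mult_smultl q_smult mult_closed mult.assoc mult_left_mono)
  show "p (z \<odot> a) = cmod z * p a" for z
  proof (cases "z = 0")
    case True
    then show ?thesis using le[OF a, of z] p_nonneg[of "z \<odot> a"] a by simp
  next
    case False
    \<comment> \<open>The inequality \<open>le\<close> for \<open>1 / z\<close>, applied to
      \<open>z \<odot> a\<close>, gives the reverse inequality for \<open>z\<close>.\<close>
    then have "(1 / z) \<odot> (z \<odot> a) = a" using a csmult_assoc[of a "1 / z" z] smult_one[of a] by simp
    then have "p a \<le> cmod (1 / z) * p (z \<odot> a)" using le[of "z \<odot> a" "1 / z"] a by simp
    then have "cmod z * p a \<le> p (z \<odot> a)" using False by (simp add: norm_divide field_simps)
    then show ?thesis using le[OF a, of z] by simp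
  qed
  have mult: "p (b \<otimes> c) \<le> p b * p c" if "b \<in> carrier A" "c \<in> carrier A" for b c
  proof (rule p_le)
    fix h assume h: "h \<in> carrier A"
    have "q (b \<otimes> (c \<otimes> h)) \<le> p b * q (c \<otimes> h)" using that h by (intro q_le) (auto simp: mult_closed)
    also have "\<dots> \<le> p b * (p c * q h)" using that h p_nonneg q_le by (intro mult_left_mono) auto
    finally show "q (b \<otimes> c \<otimes> h) \<le> p b * p c * q h" using that h by (simp add: mult_assoc mult.assoc)
  qed (use that p_nonneg in auto)
  show "p (star A a \<otimes> a) = (p a)\<^sup>2"
  proof (rule antisym)
    have "p (star A a \<otimes> a) \<le> p (star A a) * p a" using a by (intro mult) (auto simp: star_closed)
    also have "\<dots> \<le> (p a)\<^sup>2"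
      using p_star_le[OF a] p_nonneg[OF a] by (simp add: power2_eq_square mult_right_mono)
    finally show "p (star A a \<otimes> a) \<le> (p a)\<^sup>2" .
    have aa: "star A a \<otimes> a \<in> carrier A" using a by (simp add: star_closed mult_closed)
    \<comment> \<open>The hard half of the C*-identity: \<open>q_adjoint\<close> bounds
      \<open>q (a \<otimes> h)\<close> through the operator norm of
      \<open>star A a \<otimes> a\<close>.\<close>
    have "p a \<le> sqrt (p (star A a \<otimes> a))"
    proof (rule p_le)
      fix h assume h: "h \<in> carrier A"
      have "(q (a \<otimes> h))\<^sup>2 \<le> q h * q (star A a \<otimes> (a \<otimes> h))" using a h by (rule q_adjoint)
      also have "\<dots> \<le> q h * (p (star A a \<otimes> a) * q h)"
        using q_le[OF aa h] q_nonneg[OF h] a h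
        by (simp add: mult_assoc star_closed mult_left_mono)
      also have "\<dots> = (sqrt (p (star A a \<otimes> a)) * q h)\<^sup>2"
        using p_nonneg[OF aa] by (simp add: power2_eq_square)
      finally show "q (a \<otimes> h) \<le> sqrt (p (star A a \<otimes> a)) * q h"
        using p_nonneg[OF aa] q_nonneg[OF h] by - (rule power2_le_imp_le, auto)
    qed (use p_nonneg[OF aa] in simp)
    then show "(p a)\<^sup>2 \<le> p (star A a \<otimes> a)"
      using p_nonneg[OF a] p_nonneg[OF aa] by (metis power_mono real_sqrt_pow2)
  qed
  fix b assume b: "b \<in> carrier A"
  show "p (a \<otimes> b) \<le> p a * p b" using a b by (rule mult)
  show "p (a \<oplus> b) \<le> p a + p b"
  proof (rule p_le)
    fix h assume h: "h \<in> carrier A"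
    have "q ((a \<oplus> b) \<otimes> h) \<le> q (a \<otimes> h) + q (b \<otimes> h)"
      using a b h by (simp add: mult_distl q_add mult_closed)
    also have "\<dots> \<le> p a * q h + p b * q h" using a b h by (intro add_mono q_le)
    finally show "q ((a \<oplus> b) \<otimes> h) \<le> (p a + p b) * q h" by (simp add: distrib_right)
  qed (use a b p_nonneg in auto)
qed

text \<open>With a self-adjoint unit \<open>e\<close> for \<open>a\<close>, the value
  \<open>t a\<close> is the inner product of \<open>e\<close> with \<open>a \<otimes> e\<close>, so
  Cauchy-Schwarz brings in the operator norm.\<close>

lemma t_le_gns:
  assumes e: "e \<in> carrier A" "star A e = e" "e \<otimes> a = a" "a \<otimes> e = a" and a: "a \<in> carrier A"
  shows "cmod (t a) \<le> (q e)\<^sup>2 * p a"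
proof -
  have "cmod (t a) \<le> q e * q a" using t_cauchy_schwarz[OF e(1) a] e by simp
  also have "\<dots> \<le> q e * (p a * q e)"
    using q_le[OF a e(1)] e q_nonneg by (intro mult_left_mono) auto
  finally show ?thesis by (simp add: power2_eq_square algebra_simps)
qed

end

section \<open>Traces\<close>

lemma tracialD:
  assumes "tracial A \<tau>" "a \<in> carrier A"
  shows "\<tau> (z \<odot>\<^bsub>A\<^esub> a) = z * \<tau> a" "\<tau> (star A a \<otimes>\<^bsub>A\<^esub> a) \<in> \<real>\<^sub>\<ge>\<^sub>0"
    "b \<in> carrier A \<Longrightarrow> \<tau> (a \<oplus>\<^bsub>A\<^esub> b) = \<tau> a + \<tau> b"
    "b \<in> carrier A \<Longrightarrow> \<tau> (a \<otimes>\<^bsub>A\<^esub> b) = \<tau> (b \<otimes>\<^bsub>A\<^esub> a)"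
  using assms unfolding tracial_def by blast+

lemma star_homD:
  assumes "star_hom A B f" "a \<in> carrier A"
  shows "f a \<in> carrier B" "f (z \<odot>\<^bsub>A\<^esub> a) = z \<odot>\<^bsub>B\<^esub> f a" "f (star A a) = star B (f a)"
    "b \<in> carrier A \<Longrightarrow> f (a \<oplus>\<^bsub>A\<^esub> b) = f a \<oplus>\<^bsub>B\<^esub> f b"
    "b \<in> carrier A \<Longrightarrow> f (a \<otimes>\<^bsub>A\<^esub> b) = f a \<otimes>\<^bsub>B\<^esub> f b"
  using assms unfolding star_hom_def by blast+

lemma (in star_algebra) tracial_comp_star_hom:
  assumes "tracial B \<tau>" "star_hom A B f"
  shows "tracial A (\<lambda>a. \<tau> (f a))"
  unfolding tracial_def
proof (intro conjI ballI allI)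
  fix a b assume "a \<in> carrier A" "b \<in> carrier A"
  then show "\<tau> (f (a \<otimes> b)) = \<tau> (f (b \<otimes> a))"
    using tracialD(4)[OF assms(1)] by (simp only: star_homD[OF assms(2)])
qed (simp_all add: star_homD[OF assms(2)] tracialD(1-3)[OF assms(1)] star_closed)

text \<open>Positivity survives because \<open>P \<otimes> (star A a \<otimes> a)\<close> equals
  \<open>star A (P \<otimes> a) \<otimes> (P \<otimes> a)\<close>. This is how a trace is cut down
  to one component.\<close>

lemma (in star_algebra) tracial_central_projection:
  assumes \<tau>: "tracial A \<tau>"
    and P: "P \<in> carrier A" "star A P = P" "P \<otimes> P = P" "\<And>a. a \<in> carrier A \<Longrightarrow> a \<otimes> P = P \<otimes> a"
  shows "tracial A (\<lambda>a. \<tau> (P \<otimes> a))"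
  unfolding tracial_def
proof (intro conjI ballI allI)
  note cl = mult_closed[OF P(1)]
  fix a assume a: "a \<in> carrier A"
  show "\<tau> (P \<otimes> (z \<odot> a)) = z * \<tau> (P \<otimes> a)" for z
    using a P(1) cl by (simp add: mult_smultr tracialD(1)[OF \<tau>])
  have "star A (P \<otimes> a) \<otimes> (P \<otimes> a) = (star A a \<otimes> P) \<otimes> (P \<otimes> a)"
    using a P(1,2) by (simp add: star_mult)
  also have "\<dots> = star A a \<otimes> ((P \<otimes> P) \<otimes> a)"
    using a P(1) by (simp add: mult_assoc mult_closed star_closed)
  also have "\<dots> = (star A a \<otimes> P) \<otimes> a" using a P(1,3) by (simp add: mult_assoc star_closed)
  also have "\<dots> = P \<otimes> (star A a \<otimes> a)"
    using a P(1) by (simp only: P(4) star_closed mult_assoc)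
  finally show "\<tau> (P \<otimes> (star A a \<otimes> a)) \<in> \<real>\<^sub>\<ge>\<^sub>0" using tracialD(2)[OF \<tau> cl[OF a]] by simp
  fix b assume b: "b \<in> carrier A"
  show "\<tau> (P \<otimes> (a \<oplus> b)) = \<tau> (P \<otimes> a) + \<tau> (P \<otimes> b)"
    using a b P(1) cl by (simp add: mult_distr tracialD(3)[OF \<tau>])
  have "\<tau> (P \<otimes> (a \<otimes> b)) = \<tau> (b \<otimes> (P \<otimes> a))"
    using tracialD(4)[OF \<tau> cl[OF a] b] mult_assoc[OF P(1) a b] by simp
  also have "b \<otimes> (P \<otimes> a) = P \<otimes> (b \<otimes> a)"
    using mult_assoc[OF b P(1) a] mult_assoc[OF P(1) b a] P(4)[OF b] by simp
  finally show "\<tau> (P \<otimes> (a \<otimes> b)) = \<tau> (P \<otimes> (b \<otimes> a))" .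
qed

text \<open>Domination by \<open>p\<close> makes \<open>t\<close> uniformly continuous, so it
  converges along Cauchy sequences to a limit that depends only on the class. All trace properties
  pass to the limit.\<close>

lemma (in cstar_seminormed) tracial_extend:
  assumes t: "tracial A t" and bd: "\<And>a. a \<in> carrier A \<Longrightarrow> cmod (t a) \<le> c * p a"
  shows "\<exists>T. tracial K T \<and> (\<forall>a\<in>carrier A. T (cl (\<lambda>_. a)) = t a)"
proof -
  have t_add: "t (a \<oplus> b) = t a + t b" and t_comm: "t (a \<otimes> b) = t (b \<otimes> a)"
    if "a \<in> carrier A" "b \<in> carrier A" for a b using tracialD(3,4)[OF t] that by blast+
  have t_smult: "t (z \<odot> a) = z * t a" and t_pos: "t (star A a \<otimes> a) \<in> \<real>\<^sub>\<ge>\<^sub>0"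
    if "a \<in> carrier A" for a z using tracialD(1,2)[OF t] that by blast+
  have t_diff: "t a - t b = t (a \<ominus> b)" if "a \<in> carrier A" "b \<in> carrier A" for a b
    using that by (simp add: diff_smult t_add t_smult)
  have conv: "convergent (\<lambda>n. t (s n))" if s: "s \<in> C" for s
    unfolding Cauchy_convergent_iff[symmetric]
  proof (rule CauchyI')
    note cs = Cauchy_carrier[OF s]
    fix e :: real assume e: "e > 0"
    \<comment> \<open>No sign is assumed for \<open>c\<close>; \<open>\<bar>c\<bar> + 1\<close> is a
      positive bound above it.\<close>
    then have "e / (\<bar>c\<bar> + 1) > 0" by simp
    then obtain N where N: "\<And>m n. \<lbrakk>m \<ge> N; n \<ge> N\<rbrakk> \<Longrightarrow> p (s m \<ominus> s n) < e / (\<bar>c\<bar> + 1)"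
      using CauchyE[OF s] by blast
    have "dist (t (s m)) (t (s n)) < e" if "m \<ge> N" "n \<ge> N" for m n
    proof -
      have "cmod (t (s m) - t (s n)) \<le> c * p (s m \<ominus> s n)"
        using bd[of "s m \<ominus> s n"] cs by (simp add: t_diff)
      also have "\<dots> \<le> (\<bar>c\<bar> + 1) * p (s m \<ominus> s n)"
        using p_nonneg cs by (intro mult_right_mono) auto
      also have "\<dots> < e" using N[OF that] by (simp add: field_simps)
      finally show ?thesis by (simp add: dist_norm)
    qed
    then show "\<exists>M. \<forall>m\<ge>M. \<forall>n>m. dist (t (s m)) (t (s n)) < e"
      by (meson less_imp_le order_trans)
  qed
  \<comment> \<open>The representative is picked by choice; the next step shows that every
    representative gives the same limit.\<close>
  define T where "T = (\<lambda>X. lim (\<lambda>n. t ((SOME s. s \<in> X) n)))"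
  have T: "(\<lambda>n. t (s n)) \<longlonglongrightarrow> T (cl s)" if s: "s \<in> C" for s
  proof -
    define r where "r = (SOME r. r \<in> cl s)"
    have "r \<in> cl s" unfolding r_def using equiv_class_self[OF equiv_null s] by (rule someI[where P = "\<lambda>r. r \<in> cl s"])
    then have r: "r \<in> C" "(\<lambda>n. p (s n \<ominus> r n)) \<longlonglongrightarrow> 0" using null_relD by auto
    have "(\<lambda>n. t (s n) - t (r n)) \<longlonglongrightarrow> 0"
    proof (rule Lim_null_comparison)
      show "(\<lambda>n. c * p (s n \<ominus> r n)) \<longlonglongrightarrow> 0" using r(2) by (rule tendsto_mult_right_zero)
      show "\<forall>\<^sub>F n in sequentially. cmod (t (s n) - t (r n)) \<le> c * p (s n \<ominus> r n)"
        using bd Cauchy_carrier[OF s] Cauchy_carrier[OF r(1)] by (simp add: t_diff)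
    qed
    moreover have "(\<lambda>n. t (r n)) \<longlonglongrightarrow> T (cl s)"
      using conv[OF r(1)] by (simp add: T_def r_def convergent_LIMSEQ_iff)
    ultimately show ?thesis using tendsto_add[of "\<lambda>n. t (s n) - t (r n)" 0 _ "\<lambda>n. t (r n)"] by simp
  qed
  have TI: "T (cl s) = l" if "s \<in> C" "(\<lambda>n. t (s n)) \<longlonglongrightarrow> l" for s l
    using T[OF that(1)] that(2) LIMSEQ_unique by blast
  have "tracial K T"
    unfolding tracial_def
  proof (intro conjI ballI allI)
    fix X assume "X \<in> carrier K" then obtain s where s: "s \<in> C" "X = cl s" by (rule carrierE)
    note cs = Cauchy_carrier[OF s(1)]
    show "T (z \<odot>\<^bsub>K\<^esub> X) = z * T X" for z
      unfolding s(2) smult_cl[OF s(1)] using tendsto_mult_left[OF T[OF s(1)], of z] cs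
      by (intro TI smult_C s(1)) (simp add: t_smult)
    show "T (star K X \<otimes>\<^bsub>K\<^esub> X) \<in> \<real>\<^sub>\<ge>\<^sub>0"
      unfolding s(2) star_cl[OF s(1)] mult_cl[OF star_C[OF s(1)] s(1)]
      by (rule closed_sequentially[OF closed_nonneg_Reals_complex])
        (use T[OF mult_C[OF star_C[OF s(1)] s(1)]] cs t_pos in auto)
    fix Y assume "Y \<in> carrier K" then obtain r where r: "r \<in> C" "Y = cl r" by (rule carrierE)
    note cr = Cauchy_carrier[OF r(1)]
    show "T (X \<oplus>\<^bsub>K\<^esub> Y) = T X + T Y"
      unfolding s(2) r(2) add_cl[OF s(1) r(1)] using tendsto_add[OF T[OF s(1)] T[OF r(1)]] cs cr
      by (intro TI add_C s(1) r(1)) (simp add: t_add)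
    show "T (X \<otimes>\<^bsub>K\<^esub> Y) = T (Y \<otimes>\<^bsub>K\<^esub> X)"
      unfolding s(2) r(2) mult_cl[OF s(1) r(1)] mult_cl[OF r(1) s(1)]
      using T[OF mult_C[OF r(1) s(1)]] t_comm[OF cs cr] by (intro TI mult_C s(1) r(1)) simp
  qed
  moreover have "T (cl (\<lambda>_. a)) = t a" if "a \<in> carrier A" for a
    using that by (intro TI const_C) auto
  ultimately show ?thesis by blast
qed

section \<open>Traces on groupoid C*-algebras\<close>

context groupoid
begin

lemma unit_arrow: assumes "v \<in> units G" shows "v \<in> arrows G" "gdom G v = v" "gcod G v = v"
  using assms cod_dom[of v] by (auto simp: units_def)

lemma dom_unit: "g \<in> arrows G \<Longrightarrow> gdom G g \<in> units G"
  and cod_unit: "g \<in> arrows G \<Longrightarrow> gcod G g \<in> units G"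
  by (simp_all add: units_def dom_closed dom_dom cod_closed dom_cod)

section \<open>Sets of units as projections in the convolution algebra\<close>

lemma indicator_carrier:
  assumes "finite S" "S \<subseteq> units G" shows "indicator S \<in> carrier CG"
  by (rule CG_memI[of _ S]) (use assms unit_arrow in \<open>auto simp: indicator_def\<close>)

text \<open>The only unit composable with an arrow on the left is its codomain, and on the right its
  domain. Hence the indicator of \<open>S\<close> merely restricts the support.\<close>

lemma conv_indicator:
  assumes S: "finite S" "S \<subseteq> units G" and f: "f \<in> carrier CG"
  shows "conv (indicator S) f = (\<lambda>g. if gcod G g \<in> S then f g else 0)"
    and "conv f (indicator S) = (\<lambda>g. if gdom G g \<in> S then f g else 0)"
proof -
  let ?T = "{g. f g \<noteq> 0}"
  have T: "finite ?T" "?T \<subseteq> arrows G" using f by (auto simp: CG_carrier)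
  have sub: "{g. indicator S g \<noteq> (0::complex)} \<subseteq> S" by (auto simp: indicator_def)
  show "conv (indicator S) f = (\<lambda>g. if gcod G g \<in> S then f g else 0)"
  proof
    fix l
    have "conv (indicator S) f l = (\<Sum>b\<in>?T. \<Sum>a\<in>S.
        if gdom G a = gcod G b \<and> gmul G a b = l then indicator S a * f b else 0)"
      \<comment> \<open>With the sum over units inside, at most one of its terms survives, namely
        \<open>a = gcod G b\<close>.\<close>
      unfolding conv_sum[OF S(1) T(1) sub order_refl] by (rule sum.swap)
    also have "\<dots> = (\<Sum>b\<in>?T. \<Sum>a\<in>S. if a = gcod G b then (if b = l then f b else 0) else 0)"
    proof (intro sum.cong refl)
      fix b a assume "b \<in> ?T" "a \<in> S"
      then have "b \<in> arrows G" "gdom G a = a" using T S unit_arrow(2) by auto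
      then show "(if gdom G a = gcod G b \<and> gmul G a b = l then indicator S a * f b else 0)
          = (if a = gcod G b then (if b = l then f b else 0) else 0)"
        using \<open>a \<in> S\<close> cod_mul_self by auto
    qed
    also have "\<dots> = (\<Sum>b\<in>?T. if b = l then (if gcod G l \<in> S then f l else 0) else 0)"
      using S by (intro sum.cong refl) auto
    also have "\<dots> = (if gcod G l \<in> S then f l else 0)" using T by simp
    finally show "conv (indicator S) f l = \<dots>" .
  qed
  show "conv f (indicator S) = (\<lambda>g. if gdom G g \<in> S then f g else 0)"
  proof
    fix l
    have "conv f (indicator S) l = (\<Sum>b\<in>?T. \<Sum>a\<in>S.
        if gdom G b = gcod G a \<and> gmul G b a = l then f b * indicator S a else 0)"
      by (rule conv_sum[OF T(1) S(1) order_refl sub])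
    also have "\<dots> = (\<Sum>b\<in>?T. \<Sum>a\<in>S. if a = gdom G b then (if b = l then f b else 0) else 0)"
    proof (intro sum.cong refl)
      fix b a assume "b \<in> ?T" "a \<in> S"
      then have "b \<in> arrows G" "gcod G a = a" using T S unit_arrow(3) by auto
      then show "(if gdom G b = gcod G a \<and> gmul G b a = l then f b * indicator S a else 0)
          = (if a = gdom G b then (if b = l then f b else 0) else 0)"
        using \<open>a \<in> S\<close> mul_dom by auto
    qed
    also have "\<dots> = (\<Sum>b\<in>?T. if b = l then (if gdom G l \<in> S then f l else 0) else 0)"
      using S by (intro sum.cong refl) auto
    also have "\<dots> = (if gdom G l \<in> S then f l else 0)" using T by simp
    finally show "conv f (indicator S) l = \<dots>" .
  qed
qed

lemma star_indicator: assumes "S \<subseteq> units G" shows "star CG (indicator S) = indicator S"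
proof -
  have inv: "v \<in> arrows G \<and> ginv G v = v" if "v \<in> S" for v
    using inv_unique[of v v] unit_arrow[of v] mul_dom[of v] that assms by auto
  show ?thesis
  proof
    fix g
    have "g \<in> S \<longleftrightarrow> g \<in> arrows G \<and> ginv G g \<in> S" using inv inv_inv by metis
    then show "star CG (indicator S) g = indicator S g"
      by (cases "g \<in> S") (auto simp: CG_simps)
  qed
qed

section \<open>From the convolution algebra to its enveloping C*-algebra\<close>

lemma env_embed_hom: "star_hom CG (groupoid_cstar G) (env_embed CG)"
proof -
  interpret P: cstar_seminormed CG "max_seminorm CG" by (rule CG_seminormed)
  show ?thesis
    unfolding star_hom_def groupoid_cstar_def enveloping_cstar_def env_embed_def
    by (intro conjI ballI allI funcsetI P.cl_carrier P.const_C)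
      (simp_all add: P.cl_simps P.const_C del: Image_singleton_iff)
qed

lemma tracial_positive_functional: assumes "tracial CG t" shows "positive_functional CG t"
  by (intro positive_functional.intro star_algebra_CG positive_functional_axioms.intro)
    (simp_all add: tracialD[OF assms])

text \<open>Induction over the span of the arrows. An arrow times its adjoint on the left is the
  projection at its domain, so left multiplication by an arrow does not increase the
  seminorm.\<close>

lemma tracial_bounded: assumes t: "tracial CG t" shows "bounded_positive_functional CG t"
proof (intro bounded_positive_functional.intro bounded_positive_functional_axioms.intro
    tracial_positive_functional[OF t])
  interpret F: positive_functional CG t using t by (rule tracial_positive_functional)
  fix a assume "a \<in> carrier CG"
  then show "\<exists>c\<ge>0. \<forall>h\<in>carrier CG. F.q (conv a h) \<le> c * F.q h"
  proof (induction a rule: CG_induct)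
    case (delta z g)
    have "F.q (conv (\<lambda>h. z * arrow_delta g h) h) \<le> cmod z * F.q h" if h: "h \<in> carrier CG" for h
    proof -
      note dg = delta_carrier[OF delta] delta_carrier[OF dom_closed[OF delta]]
      let ?d = "arrow_delta (gdom G g)"
      have "star CG ?d = ?d"
        using delta inv_unique[of "gdom G g" "gdom G g"] mul_dom[of "gdom G g"]
        by (simp add: star_delta dom_closed dom_dom cod_dom)
      moreover have "conv (star CG (arrow_delta g)) (arrow_delta g) = ?d"
        using delta by (simp add: star_delta conv_delta dom_inv inv_mul)
      moreover have "conv ?d ?d = ?d"
        using delta mul_dom[of "gdom G g"] by (simp add: conv_delta dom_closed dom_dom cod_dom)
      \<comment> \<open>Multiplying \<open>h\<close> by the arrow or by its domain projection gives
        the same seminorm, as both squares reduce to one expression.\<close>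
      ultimately have split:
        "conv (star CG (conv (arrow_delta g) h)) (conv (arrow_delta g) h) = conv (star CG h) (conv ?d h)"
        "conv (star CG (conv ?d h)) (conv ?d h) = conv (star CG h) (conv ?d h)"
        using h dg by (simp_all add: star_conv conv_assoc conv_closed star_carrier)
          (simp_all add: conv_assoc[symmetric] conv_closed star_carrier h dg)
      have dh: "conv ?d h \<in> carrier CG" using h dg by (simp add: conv_closed)
      have eq: "F.q (conv (arrow_delta g) h) = F.q (conv ?d h)" by (simp add: functional_norm_def split)
      \<comment> \<open>A projection is contractive: apply Cauchy-Schwarz and cancel one
        factor.\<close>
      have "F.q (conv ?d h) * F.q (conv ?d h) = cmod (t (conv (star CG h) (conv ?d h)))"
        using F.t_star_self[OF dh] F.q_nonneg[OF dh] by (simp add: split power2_eq_square norm_mult)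
      also have "\<dots> \<le> F.q h * F.q (conv ?d h)" using h dh by (rule F.t_cauchy_schwarz)
      finally have "F.q (conv ?d h) \<le> F.q h"
        using F.q_nonneg[OF dh] F.q_nonneg[OF h] by (cases "F.q (conv ?d h) = 0") auto
      then show ?thesis
        using F.q_smult[of "conv (arrow_delta g) h" z] h dg eq
        by (simp add: conv_lin conv_closed CG_simps(1-3) mult_left_mono)
    qed
    then show ?case by (intro exI[of _ "cmod z"]) auto
  next
    case (add a b)
    then obtain c e where c: "0 \<le> c" "\<And>h. h \<in> carrier CG \<Longrightarrow> F.q (conv a h) \<le> c * F.q h"
      and e: "0 \<le> e" "\<And>h. h \<in> carrier CG \<Longrightarrow> F.q (conv b h) \<le> e * F.q h" by blast
    have "F.q (conv (\<lambda>g. a g + b g) h) \<le> (c + e) * F.q h" if h: "h \<in> carrier CG" for h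
      using F.q_add[of "conv a h" "conv b h"] c(2)[OF h] e(2)[OF h] h add
      by (simp add: conv_lin conv_closed CG_simps(1-3) distrib_right)
    then show ?case using c e by (intro exI[of _ "c + e"]) auto
  next
    case zero
    have "F.q (\<lambda>_. 0) = 0" using F.q_smult[OF zero_carrier, of 0] by (simp add: CG_simps)
    then show ?case by (intro exI[of _ 0]) (simp add: conv_zero)
  qed
qed

text \<open>Finiteness of the unit space makes its indicator the identity of the convolution
  algebra. This single \<open>e\<close> in \<open>t_le_gns\<close> bounds \<open>t\<close> by the
  operator seminorm, hence by the maximal one.\<close>

lemma tracial_extend_cstar:
  assumes fin: "finite (units G)" and t: "tracial CG t"
  shows "\<exists>T. tracial (groupoid_cstar G) T \<and> (\<forall>f\<in>carrier CG. T (env_embed CG f) = t f)"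
proof -
  interpret F: bounded_positive_functional CG t using t by (rule tracial_bounded)
  let ?e = "indicator (units G) :: 'g \<Rightarrow> complex"
  have "cmod (t f) \<le> (F.q ?e)\<^sup>2 * max_seminorm CG f" if f: "f \<in> carrier CG" for f
  proof -
    \<comment> \<open>Outside the arrows \<open>gdom\<close> and \<open>gcod\<close> are arbitrary,
      but \<open>f\<close> vanishes there.\<close>
    have "f g = 0" if "g \<notin> arrows G" for g using f that by (auto simp: CG_carrier)
    then have z: "f g = 0" if "gcod G g \<notin> units G \<or> gdom G g \<notin> units G" for g
      using that cod_unit dom_unit by blast
    have "conv ?e f = f" "conv f ?e = f"
      unfolding conv_indicator[OF fin order_refl f] using z by auto
    then have "cmod (t f) \<le> (F.q ?e)\<^sup>2 * gns_norm CG t f"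
      using f fin by (intro F.t_le_gns) (auto simp: indicator_carrier star_indicator)
    also have "\<dots> \<le> (F.q ?e)\<^sup>2 * max_seminorm CG f"
      by (intro mult_left_mono le_max_seminorm F.cstar_seminorm_gns f) simp
    finally show ?thesis .
  qed
  from cstar_seminormed.tracial_extend[OF CG_seminormed t this] show ?thesis
    by (simp add: groupoid_cstar_def enveloping_cstar_def env_embed_def)
qed

text \<open>Exchanging \<open>g\<close> with its domain unit turns a product equal to
  \<open>g\<close> into zero unless \<open>g\<close> is a loop. For conjugation, write
  \<open>g\<close> as \<open>k\<close> times \<open>?l\<close> and exchange the two factors.\<close>

lemma tracial_delta:
  assumes t: "tracial CG t" and g: "g \<in> arrows G"
  shows "gdom G g \<noteq> gcod G g \<Longrightarrow> t (arrow_delta g) = 0"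
    and "\<lbrakk>k \<in> arrows G; gcod G k = gcod G g; gdom G g = gcod G g\<rbrakk> \<Longrightarrow>
      t (arrow_delta (gmul G (gmul G (ginv G k) g) k)) = t (arrow_delta g)"
proof -
  have tz: "t (\<lambda>_. 0) = 0" using tracialD(1)[OF t zero_carrier, of 0] by (simp add: CG_simps)
  have tc: "t (conv (arrow_delta a) (arrow_delta b)) = t (conv (arrow_delta b) (arrow_delta a))"
    if "a \<in> arrows G" "b \<in> arrows G" for a b
    using tracialD(4)[OF t] that delta_carrier by blast
  show "t (arrow_delta g) = 0" if "gdom G g \<noteq> gcod G g"
    using tc[OF g dom_closed[OF g]] that g by (simp add: conv_delta cod_dom dom_dom mul_dom tz)
  assume k: "k \<in> arrows G" "gcod G k = gcod G g" "gdom G g = gcod G g"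
  let ?l = "gmul G (ginv G k) g"
  have l: "?l \<in> arrows G" "gdom G ?l = gdom G g" "gcod G ?l = gdom G k"
    using k g by (simp_all add: mul_closed inv_closed dom_inv cod_inv dom_mul cod_mul)
  have "gmul G k ?l = g"
    using k g by (simp add: mul_assoc[symmetric] inv_closed dom_inv cod_inv mul_inv cod_mul_self)
  then show "t (arrow_delta (gmul G ?l k)) = t (arrow_delta g)"
    using tc[OF l(1) k(1)] k l by (simp add: conv_delta)
qed

end

section \<open>Traces on a connected component\<close>

locale groupoid_component = groupoid G for G :: "'g groupoid" +
  fixes C :: "'g set" and x :: 'g and k :: "'g \<Rightarrow> 'g"
  assumes component: "C \<in> units G // orbit_rel G"
    and base: "x \<in> C"
    and connecting: "connecting_arrows G C x k"
begin

lemma component_units: "C \<subseteq> units G"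
  using in_quotient_imp_subset[OF equiv_orbit_rel component] .

lemma component_closed: assumes g: "g \<in> arrows G" shows "gdom G g \<in> C \<longleftrightarrow> gcod G g \<in> C"
proof -
  have "(gdom G g, gcod G g) \<in> orbit_rel G"
    using g dom_unit cod_unit by (auto simp: orbit_rel_def)
  then show ?thesis
    using in_quotient_imp_closed[OF equiv_orbit_rel component] equiv_orbit_rel
    by (meson equivE symD)
qed

lemma base_unit: "x \<in> units G" using base component_units by blast

lemma k_arrow: assumes "y \<in> C" shows "k y \<in> arrows G" "gdom G (k y) = x" "gcod G (k y) = y"
  using connecting assms by (auto simp: connecting_arrows_def)

abbreviation H where "H \<equiv> group_groupoid (isotropy_group G x)"

text \<open>Makes all results on groupoid algebras available for the isotropy group, viewed as a
  groupoid with the single unit \<open>x\<close>.\<close>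

sublocale H: groupoid H
  by (rule groupoid_group_groupoid[OF group_isotropy[OF base_unit]])

lemma H_simps: "arrows H = {g \<in> arrows G. gdom G g = x \<and> gcod G g = x}"
  "gmul H = gmul G" "gdom H a = x" "gcod H a = x"
  by (simp_all add: group_groupoid_def isotropy_group_def)

lemma H_inv: assumes "a \<in> arrows H" shows "ginv H a = ginv G a"
  using H.inv_unique[of a "ginv G a"] assms
  by (auto simp: H_simps inv_closed dom_inv cod_inv mul_inv)

text \<open>Over \<open>C\<close> the groupoid is the product of the pair groupoid on
  \<open>C\<close> and the isotropy group at \<open>x\<close>; this is the projection to the group
  factor.\<close>

definition straighten :: "'g \<Rightarrow> 'g" where
  "straighten g = gmul G (gmul G (ginv G (k (gcod G g))) g) (k (gdom G g))"

lemmas gsimps = mul_closed inv_closed dom_mul cod_mul dom_inv cod_inv k_arrow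

lemma straighten_closed:
  assumes "g \<in> arrows G" "gcod G g \<in> C" shows "straighten g \<in> arrows H"
  using assms component_closed[OF assms(1)] by (simp add: straighten_def H_simps gsimps)

text \<open>Codomain, straightened arrow and domain together are coordinates for the arrows over
  \<open>C\<close>. The left side of the equivalence is the inverse of this coordinate map.\<close>

lemma straighten_unique:
  assumes "y \<in> C" "z \<in> C" "h \<in> arrows H" "g \<in> arrows G"
  shows "gmul G (gmul G (k y) h) (ginv G (k z)) = g \<longleftrightarrow>
    gcod G g = y \<and> gdom G g = z \<and> h = straighten g"
proof
  assume g: "gmul G (gmul G (k y) h) (ginv G (k z)) = g"
  have yz: "gcod G g = y" "gdom G g = z"
    using assms by (auto simp: g[symmetric] H_simps gsimps)
  have "straighten g = gmul G (gmul G (ginv G (k y)) (k y)) (gmul G h (gmul G (ginv G (k z)) (k z)))"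
    using assms unfolding straighten_def yz by (auto simp: g[symmetric] H_simps gsimps mul_assoc)
  also have "\<dots> = h"
    using assms mul_dom[of h] cod_mul_self[of h] by (auto simp: H_simps inv_mul k_arrow)
  finally show "gcod G g = y \<and> gdom G g = z \<and> h = straighten g" using yz by simp
next
  assume g: "gcod G g = y \<and> gdom G g = z \<and> h = straighten g"
  have "gmul G (gmul G (k y) h) (ginv G (k z)) =
      gmul G (gmul G (k y) (ginv G (k y))) (gmul G g (gmul G (k z) (ginv G (k z))))"
    using assms g by (auto simp: straighten_def gsimps mul_assoc)
  also have "\<dots> = g"
    using assms g mul_dom[of g] cod_mul_self[of g] by (auto simp: mul_inv k_arrow)
  finally show "gmul G (gmul G (k y) h) (ginv G (k z)) = g" .
qed

text \<open>At the middle unit \<open>k\<close> meets its own inverse and cancels.\<close>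

lemma straighten_mul:
  assumes "a \<in> arrows G" "b \<in> arrows G" "gdom G a = gcod G b" "gcod G a \<in> C"
  shows "straighten (gmul G a b) = gmul G (straighten a) (straighten b)"
proof -
  have c: "gdom G a \<in> C" "gcod G b \<in> C" "gdom G b \<in> C"
    using assms component_closed[of a] component_closed[of b] by auto
  have "gmul G (straighten a) (straighten b) =
    gmul G (ginv G (k (gcod G a))) (gmul G a (gmul G (gmul G (k (gcod G b)) (ginv G (k (gcod G b))))
      (gmul G b (k (gdom G b)))))"
    using assms c by (simp add: straighten_def gsimps mul_assoc)
  also have "\<dots> = straighten (gmul G a b)"
    using assms c cod_mul_self[of "gmul G b (k (gdom G b))"]
    by (simp add: straighten_def gsimps mul_inv mul_assoc)
  finally show ?thesis by simp
qed

text \<open>The entry in row \<open>y\<close> and column \<open>z\<close> when the part of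
  \<open>f\<close> over \<open>C\<close> is read as a matrix over the group algebra of the isotropy
  group.\<close>

definition block :: "'g \<Rightarrow> 'g \<Rightarrow> ('g \<Rightarrow> complex) \<Rightarrow> 'g \<Rightarrow> complex" where
  "block y z f = (\<lambda>h. if h \<in> arrows H then f (gmul G (gmul G (k y) h) (ginv G (k z))) else 0)"

lemma block_lin: "block y z (\<lambda>g. f g + h g) = (\<lambda>g. block y z f g + block y z h g)"
  "block y z (\<lambda>g. c * f g) = (\<lambda>g. c * block y z f g)" "block y z (\<lambda>_. 0) = (\<lambda>_. 0)"
  by (auto simp: block_def)

lemma block_delta:
  assumes "y \<in> C" "z \<in> C" "g \<in> arrows G"
  shows "block y z (arrow_delta g) =
    (if gcod G g = y \<and> gdom G g = z then arrow_delta (straighten g) else (\<lambda>_. 0))"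
proof
  fix h
  show "block y z (arrow_delta g) h =
      (if gcod G g = y \<and> gdom G g = z then arrow_delta (straighten g) else (\<lambda>_. 0)) h"
    using straighten_unique[OF assms(1,2) _ assms(3), of h] straighten_closed[OF assms(3)] assms
    by (auto simp: block_def arrow_delta_def)
qed

lemma block_carrier:
  assumes "f \<in> carrier CG" "y \<in> C" "z \<in> C" shows "block y z f \<in> carrier H.CG"
  using assms(1)
  by (induction f rule: CG_induct)
    (use assms straighten_closed in \<open>auto simp: block_lin block_delta H.CG_closed\<close>)

text \<open>Inverting \<open>k y\<close>, \<open>h\<close>, inverse of \<open>k z\<close> exchanges
  the outer factors, so the adjoint transposes the matrix and takes the adjoint of each
  entry.\<close>

lemma block_star:
  assumes "y \<in> C" "z \<in> C" shows "block y z (star CG f) = star H.CG (block z y f)"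
proof
  fix h
  show "block y z (star CG f) h = star H.CG (block z y f) h"
  proof (cases "h \<in> arrows H")
    case True
    then have "ginv G (gmul G (gmul G (k y) h) (ginv G (k z))) = gmul G (gmul G (k z) (ginv G h)) (ginv G (k y))"
      using assms by (simp add: H_simps inv_gmul gsimps inv_inv mul_assoc)
    moreover have "gmul G (gmul G (k y) h) (ginv G (k z)) \<in> arrows G"
      using True assms by (simp add: H_simps gsimps)
    ultimately show ?thesis
      using True H.inv_closed[OF True] H_inv[OF True] by (simp add: block_def CG_simps H.CG_simps)
  qed (simp add: block_def H.CG_simps)
qed

text \<open>The matrix trace followed by \<open>t\<close>.\<close>

definition induced_functional :: "(('g \<Rightarrow> complex) \<Rightarrow> complex) \<Rightarrow> ('g \<Rightarrow> complex) \<Rightarrow> complex" where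
  "induced_functional t f = (\<Sum>y\<in>C. t (block y y f))"

section \<open>The induced functional is a trace\<close>

context
  fixes t :: "('g \<Rightarrow> complex) \<Rightarrow> complex"
  assumes fin: "finite C" and t: "tracial H.CG t"
begin

lemma t_lin:
  "\<lbrakk>f \<in> carrier H.CG; h \<in> carrier H.CG\<rbrakk> \<Longrightarrow> t (\<lambda>g. f g + h g) = t f + t h"
  "f \<in> carrier H.CG \<Longrightarrow> t (\<lambda>g. c * f g) = c * t f"
  "t (\<lambda>_. 0) = 0"
  using tracialD(3)[OF t, of f h] tracialD(1)[OF t, of f c] tracialD(1)[OF t H.zero_carrier, of 0]
  by (simp_all add: H.CG_simps)

lemma induced_lin:
  "\<lbrakk>f \<in> carrier CG; h \<in> carrier CG\<rbrakk> \<Longrightarrow>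
    induced_functional t (\<lambda>g. f g + h g) = induced_functional t f + induced_functional t h"
  "f \<in> carrier CG \<Longrightarrow> induced_functional t (\<lambda>g. c * f g) = c * induced_functional t f"
  "induced_functional t (\<lambda>_. 0) = 0"
  by (simp_all add: induced_functional_def block_lin t_lin block_carrier sum.distrib sum_distrib_left)

lemma induced_delta:
  assumes "g \<in> arrows G"
  shows "induced_functional t (arrow_delta g) =
    (if gdom G g = gcod G g \<and> gcod G g \<in> C then t (arrow_delta (straighten g)) else 0)"
proof -
  have "induced_functional t (arrow_delta g) =
      (\<Sum>y\<in>C. if gcod G g = y then (if gdom G g = y then t (arrow_delta (straighten g)) else 0) else 0)"
    unfolding induced_functional_def using assms
    by (intro sum.cong) (auto simp: block_delta t_lin)
  then show ?thesis using fin by (auto simp: eq_commute)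
qed

text \<open>The diagonal of a matrix product. Both sides are bilinear, so the claim reduces to two
  arrows, where it is \<open>straighten_mul\<close>.\<close>

lemma induced_conv:
  assumes "a \<in> carrier CG" "b \<in> carrier CG"
  shows "induced_functional t (conv a b) = (\<Sum>y\<in>C. \<Sum>z\<in>C. t (H.conv (block y z a) (block z y b)))"
  using assms(1)
proof (induction a rule: CG_induct)
  case (delta c g)
  show ?case using assms(2)
  proof (induction b rule: CG_induct)
    case (delta d h)
    note gh = \<open>g \<in> arrows G\<close> \<open>h \<in> arrows G\<close>
    \<comment> \<open>Only \<open>y = gcod G g\<close> and \<open>z = gdom G g\<close> can
      contribute; nesting the conditions lets each sum collapse to that index.\<close>
    have "(\<Sum>y\<in>C. \<Sum>z\<in>C. t (H.conv (block y z (arrow_delta g)) (block z y (arrow_delta h)))) =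
      (\<Sum>y\<in>C. if gcod G g = y then \<Sum>z\<in>C. if gdom G g = z then
         if gcod G h = z \<and> gdom G h = y then t (arrow_delta (gmul G (straighten g) (straighten h)))
         else 0 else 0 else 0)"
      using gh by (intro sum.cong refl)
        (auto simp: block_delta t_lin H.conv_zero H.conv_delta H_simps intro!: sum.cong sum.neutral)
    also have "\<dots> = (if gcod G g \<in> C \<and> gcod G h = gdom G g \<and> gdom G h = gcod G g
       then t (arrow_delta (gmul G (straighten g) (straighten h))) else 0)"
      using fin component_closed[OF gh(1)] by auto
    also have "\<dots> = induced_functional t (conv (arrow_delta g) (arrow_delta h))"
      using gh by (auto simp: conv_delta induced_delta induced_lin mul_closed dom_mul cod_mul
          straighten_mul)
    finally have eq: "induced_functional t (conv (arrow_delta g) (arrow_delta h)) =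
      (\<Sum>y\<in>C. \<Sum>z\<in>C. t (H.conv (block y z (arrow_delta g)) (block z y (arrow_delta h))))" by simp
    show ?case
      using gh by (simp add: conv_lin CG_closed induced_lin eq block_lin H.conv_lin H.CG_closed
          block_carrier t_lin sum_distrib_left)
  next
    case (add b b')
    then show ?case using \<open>g \<in> arrows G\<close>
      by (simp add: conv_lin CG_closed induced_lin block_lin H.conv_lin H.CG_closed
          block_carrier t_lin sum.distrib)
  next
    case zero
    show ?case by (simp add: conv_lin induced_lin block_lin H.conv_lin t_lin)
  qed
next
  case (add a a')
  then show ?case using assms(2)
    by (simp add: conv_lin CG_closed induced_lin block_lin H.conv_lin H.CG_closed
        block_carrier t_lin sum.distrib)
next
  case zero
  show ?case by (simp add: conv_lin induced_lin block_lin H.conv_lin t_lin)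
qed

text \<open>By \<open>induced_conv\<close> and \<open>block_star\<close>, positivity is a sum of
  values of \<open>t\<close> at an entry times its adjoint. The trace property swaps the two sums
  and uses that of \<open>t\<close> entrywise.\<close>

lemma tracial_induced: "tracial CG (induced_functional t)"
  unfolding tracial_def CG_simps(1,2)
proof (intro conjI ballI allI)
  fix a assume a: "a \<in> carrier CG"
  have "induced_functional t (conv (star CG a) a) =
      (\<Sum>y\<in>C. \<Sum>z\<in>C. t (H.conv (star H.CG (block z y a)) (block z y a)))"
    using a by (simp add: induced_conv star_carrier block_star)
  also have "\<dots> \<in> \<real>\<^sub>\<ge>\<^sub>0"
    using tracialD(2)[OF t block_carrier[OF a]]
    by (simp add: complex_nonneg_Reals_iff sum_nonneg)
  finally show "induced_functional t (conv (star CG a) a) \<in> \<real>\<^sub>\<ge>\<^sub>0" .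
  fix b assume b: "b \<in> carrier CG"
  show "induced_functional t (conv a b) = induced_functional t (conv b a)"
    unfolding induced_conv[OF a b] induced_conv[OF b a]
    by (subst sum.swap) (intro sum.cong refl tracialD(4)[OF t] block_carrier a b)
qed (simp_all add: induced_lin)

end

section \<open>Inducing from and restricting to the isotropy group\<close>

lemma induced_trace_exists:
  assumes fin: "finite (units G)" and \<tau>: "tracial (group_cstar (isotropy_group G x)) \<tau>"
  shows "\<exists>\<tau>'. induced_trace G C x k \<tau> \<tau>'"
proof -
  interpret HA: star_algebra H.CG by (rule H.star_algebra_CG)
  \<comment> \<open>The trace is pulled back to the group algebra, induced there, and only then
    extended to the completion.\<close>
  let ?t = "\<lambda>f. \<tau> (env_embed H.CG f)"
  have t: "tracial H.CG ?t"
    using HA.tracial_comp_star_hom[OF _ H.env_embed_hom] \<tau> by (simp add: group_cstar_def)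
  have C: "finite C" using fin component_units finite_subset by blast
  obtain \<tau>' where "tracial (groupoid_cstar G) \<tau>'"
    "\<And>f. f \<in> carrier CG \<Longrightarrow> \<tau>' (env_embed CG f) = induced_functional ?t f"
    using tracial_extend_cstar[OF fin tracial_induced[OF C t]] by blast
  then show ?thesis
    unfolding induced_trace_def
    by (auto simp: canonical_rep_def group_canonical_rep_def delta_carrier induced_delta[OF C t]
        straighten_def)
qed

lemma induced_trace_component:
  assumes fin: "finite (units G)" and \<sigma>: "tracial (groupoid_cstar G) \<sigma>"
  shows "\<exists>\<tau>. tracial (group_cstar (isotropy_group G x)) \<tau> \<and>
    induced_trace G C x k \<tau> (\<lambda>X. \<sigma> (env_embed CG (indicator C) \<otimes>\<^bsub>groupoid_cstar G\<^esub> X))"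
proof -
  interpret KG: cstar_algebra "groupoid_cstar G" by (rule cstar_algebra_groupoid_cstar)
  interpret KH: cstar_algebra "groupoid_cstar H" by (rule H.cstar_algebra_groupoid_cstar)
  interpret A: star_algebra CG by (rule star_algebra_CG)
  have C: "finite C" using fin component_units finite_subset by blast
  \<comment> \<open>The canonical representation restricted to loops at \<open>x\<close>. The group
    unit goes to the projection at \<open>x\<close>, in general not the identity of the algebra,
    which \<open>unitary_rep\<close> permits.\<close>
  have U: "unitary_rep H (groupoid_cstar G) (canonical_rep G)"
  proof -
    have "units H \<subseteq> units G" using unit_arrow[OF base_unit] by (auto simp: units_def H_simps)
    then show ?thesis
      using unitary_rep_canonical unfolding unitary_rep_def by (auto simp: H_simps)
  qed
  obtain F where F: "star_hom (groupoid_cstar H) (groupoid_cstar G) F"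
    "\<And>g. g \<in> arrows H \<Longrightarrow> F (canonical_rep H g) = canonical_rep G g"
    using H.groupoid_cstar_universal[OF cstar_algebra_groupoid_cstar U] by blast
  \<comment> \<open>The witness: \<open>\<sigma>\<close> pulled back along the homomorphism that
    extends the inclusion of the isotropy group.\<close>
  have \<tau>: "tracial (groupoid_cstar H) (\<lambda>X. \<sigma> (F X))"
    by (rule KH.tracial_comp_star_hom[OF \<sigma> F(1)])
  let ?P = "env_embed CG (indicator C)"
  let ?t = "\<lambda>f. \<sigma> (env_embed CG f)"
  have t: "tracial CG ?t" by (rule A.tracial_comp_star_hom[OF \<sigma> env_embed_hom])
  have e: "indicator C \<in> carrier CG" by (rule indicator_carrier[OF C component_units])
  note hom = star_homD[OF env_embed_hom]
  \<comment> \<open>An arrow starts in \<open>C\<close> exactly if it ends there, so both products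
    restrict \<open>f\<close> to the same arrows.\<close>
  have conv_e: "conv f (indicator C) = conv (indicator C) f" if f: "f \<in> carrier CG" for f
  proof
    fix g
    show "conv f (indicator C) g = conv (indicator C) f g"
      using component_closed[of g] f unfolding conv_indicator[OF C component_units f]
      by (cases "g \<in> arrows G") (auto simp: CG_carrier)
  qed
  \<comment> \<open>Centrality carries over term by term along a representing Cauchy
    sequence.\<close>
  have comm: "X \<otimes>\<^bsub>groupoid_cstar G\<^esub> ?P = ?P \<otimes>\<^bsub>groupoid_cstar G\<^esub> X"
    if X: "X \<in> carrier (groupoid_cstar G)" for X
  proof -
    interpret P: cstar_seminormed CG "max_seminorm CG" by (rule CG_seminormed)
    obtain s where s: "s \<in> P.C" "X = P.cl s"
      using X P.carrierE by (auto simp: groupoid_cstar_def enveloping_cstar_def)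
    then show ?thesis
      using conv_e[OF P.Cauchy_carrier[OF s(1)]] e
      by (simp add: groupoid_cstar_def enveloping_cstar_def env_embed_def P.mult_cl P.const_C
          del: Image_singleton_iff)
  qed
  have "tracial (groupoid_cstar G) (\<lambda>X. \<sigma> (?P \<otimes>\<^bsub>groupoid_cstar G\<^esub> X))"
  proof (rule KG.tracial_central_projection[OF \<sigma> hom(1)[OF e] _ _ comm])
    show "star (groupoid_cstar G) ?P = ?P"
      using hom(3)[OF e] star_indicator[OF component_units] by simp
    have "conv (indicator C) (indicator C) = indicator C"
      unfolding conv_indicator(1)[OF C component_units e]
      using component_units unit_arrow(3) by (fastforce simp: indicator_def)
    then show "?P \<otimes>\<^bsub>groupoid_cstar G\<^esub> ?P = ?P" using hom(5)[OF e e] by simp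
  qed
  moreover have "\<sigma> (?P \<otimes>\<^bsub>groupoid_cstar G\<^esub> canonical_rep G g) =
      (if gdom G g = gcod G g \<and> gcod G g \<in> C
       then \<sigma> (F (group_canonical_rep (isotropy_group G x) (straighten g))) else 0)"
    if g: "g \<in> arrows G" for g
  proof -
    have "conv (indicator C) (arrow_delta g) = (\<lambda>h. (if gcod G g \<in> C then 1 else 0) * arrow_delta g h)"
      unfolding conv_indicator(1)[OF C component_units delta_carrier[OF g]]
      by (auto simp: arrow_delta_def)
    then have "\<sigma> (?P \<otimes>\<^bsub>groupoid_cstar G\<^esub> canonical_rep G g) =
        ?t (\<lambda>h. (if gcod G g \<in> C then 1 else 0) * arrow_delta g h)"
      using hom(5)[OF e delta_carrier[OF g]] by (simp add: canonical_rep_def)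
    also have "\<dots> = (if gcod G g \<in> C then ?t (arrow_delta g) else 0)"
      using tracialD(1)[OF t delta_carrier[OF g], of "if gcod G g \<in> C then 1 else 0"]
      by (simp only: CG_simps) simp
    \<comment> \<open>Non-loops have trace zero; a loop over \<open>C\<close> may be conjugated into
      the isotropy group by \<open>k\<close>.\<close>
    also have "\<dots> = (if gdom G g = gcod G g \<and> gcod G g \<in> C then ?t (arrow_delta (straighten g)) else 0)"
      using tracial_delta(1)[OF t g] tracial_delta(2)[OF t g, of "k (gcod G g)"]
      by (auto simp: straighten_def k_arrow)
    also have "\<dots> = (if gdom G g = gcod G g \<and> gcod G g \<in> C
       then \<sigma> (F (group_canonical_rep (isotropy_group G x) (straighten g))) else 0)"
      using F(2)[of "straighten g"] straighten_closed[OF g]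
      by (auto simp: group_canonical_rep_def canonical_rep_def)
    finally show ?thesis .
  qed
  ultimately have "induced_trace G C x k (\<lambda>X. \<sigma> (F X)) (\<lambda>X. \<sigma> (?P \<otimes>\<^bsub>groupoid_cstar G\<^esub> X))"
    by (simp add: induced_trace_def straighten_def)
  then show ?thesis using \<tau> unfolding group_cstar_def by blast
qed

end

text \<open>The classes partition the units, so their indicators add up to the identity; finite
  additivity of \<open>\<sigma>\<close> suffices.\<close>

lemma (in groupoid) tracial_sum_components:
  assumes fin: "finite (units G)" and \<sigma>: "tracial (groupoid_cstar G) \<sigma>"
    and X: "X \<in> carrier (groupoid_cstar G)"
  shows "\<sigma> X = (\<Sum>C\<in>units G // orbit_rel G. \<sigma> (env_embed CG (indicator C) \<otimes>\<^bsub>groupoid_cstar G\<^esub> X))"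
proof -
  interpret KG: cstar_algebra "groupoid_cstar G" by (rule cstar_algebra_groupoid_cstar)
  interpret P: cstar_seminormed CG "max_seminorm CG" by (rule CG_seminormed)
  note hom = star_homD[OF env_embed_hom]
  let ?Q = "units G // orbit_rel G"
  have sub: "\<Union>?Q = units G" by (rule Union_quotient[OF equiv_orbit_rel])
  have disj: "A \<inter> B = {}" if "A \<in> ?Q" "B \<in> ?Q" "A \<noteq> B" for A B
    using quotient_disj[OF equiv_orbit_rel that(1,2)] that(3) by blast
  have cl: "env_embed CG (indicator S) \<otimes>\<^bsub>groupoid_cstar G\<^esub> X \<in> carrier (groupoid_cstar G)"
    "indicator S \<in> carrier CG" if "S \<subseteq> units G" for S
    using indicator_carrier[OF finite_subset[OF that fin] that] hom(1) X
    by (auto intro!: KG.mult_closed)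
  have sum: "\<sigma> (env_embed CG (indicator (\<Union>R)) \<otimes>\<^bsub>groupoid_cstar G\<^esub> X) =
      (\<Sum>C\<in>R. \<sigma> (env_embed CG (indicator C) \<otimes>\<^bsub>groupoid_cstar G\<^esub> X))"
    if "finite R" "R \<subseteq> ?Q" for R
    using that
  proof (induction R rule: finite_induct)
    case empty
    \<comment> \<open>Writing the zero element as a multiple by \<open>0\<close> makes homogeneity
      of \<open>\<sigma>\<close> yield the value \<open>0\<close>.\<close>
    have z: "env_embed CG (\<lambda>_. 0) = 0 \<odot>\<^bsub>groupoid_cstar G\<^esub> env_embed CG (\<lambda>_. 0)"
      using hom(2)[OF zero_carrier, of 0] by (simp only: CG_simps mult_zero_left)
    have "\<sigma> (env_embed CG (\<lambda>_. 0) \<otimes>\<^bsub>groupoid_cstar G\<^esub> X) =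
        \<sigma> ((0 \<odot>\<^bsub>groupoid_cstar G\<^esub> env_embed CG (\<lambda>_. 0)) \<otimes>\<^bsub>groupoid_cstar G\<^esub> X)"
      by (rule arg_cong[OF z])
    also have "\<dots> = 0"
      using tracialD(1)[OF \<sigma> KG.mult_closed[OF hom(1)[OF zero_carrier] X], of 0]
        hom(1)[OF zero_carrier] X
      by (simp add: KG.mult_smultl)
    finally show ?case by (simp add: indicator_def)
  next
    case (insert C R)
    have S: "C \<subseteq> units G" "\<Union>R \<subseteq> units G" using insert.prems sub by blast+
    have "C \<inter> \<Union>R = {}" using disj insert.hyps insert.prems by blast
    then have "indicator (\<Union>(insert C R)) = (indicator C \<oplus>\<^bsub>CG\<^esub> indicator (\<Union>R) :: 'g \<Rightarrow> complex)"
      by (intro ext) (auto simp: CG_simps split: split_indicator)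
    then show ?case
      using insert S cl hom(1,4) X by (simp add: KG.mult_distl tracialD(3)[OF \<sigma>])
  qed
  obtain s where s: "s \<in> P.C" "X = P.cl s"
    using X P.carrierE by (auto simp: groupoid_cstar_def enveloping_cstar_def)
  have "conv (indicator (units G)) f = f" if f: "f \<in> carrier CG" for f
    unfolding conv_indicator[OF fin order_refl f] using f cod_unit by (fastforce simp: CG_carrier)
  then have "env_embed CG (indicator (units G)) \<otimes>\<^bsub>groupoid_cstar G\<^esub> X = X"
    using s P.Cauchy_carrier[OF s(1)] cl(2)[OF order_refl]
    by (simp add: groupoid_cstar_def enveloping_cstar_def env_embed_def P.mult_cl P.const_C
        del: Image_singleton_iff)
  moreover have "finite ?Q" using fin by (rule finite_quotient) (auto simp: orbit_rel_def)
  ultimately show ?thesis using sum[of ?Q] sub by simp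
qed

theorem corollary7p6:
  fixes G :: "'g groupoid"
  assumes "groupoid G" and "finite (units G)"
  shows "(\<forall>C \<in> units G // orbit_rel G. \<forall>x\<in>C. \<forall>k. connecting_arrows G C x k \<longrightarrow>
           (\<forall>\<tau>. tracial (group_cstar (isotropy_group G x)) \<tau> \<longrightarrow>
             (\<exists>\<tau>'. induced_trace G C x k \<tau> \<tau>')))
       \<and> (\<forall>b k. (\<forall>C \<in> units G // orbit_rel G. b C \<in> C \<and> connecting_arrows G C (b C) (k C)) \<longrightarrow>
           (\<forall>\<sigma>. tracial (groupoid_cstar G) \<sigma> \<longrightarrow>
             (\<exists>\<tau> \<tau>'.
               (\<forall>C \<in> units G // orbit_rel G.
                  tracial (group_cstar (isotropy_group G (b C))) (\<tau> C) \<and>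
                  induced_trace G C (b C) (k C) (\<tau> C) (\<tau>' C)) \<and>
               (\<forall>a \<in> carrier (groupoid_cstar G). \<sigma> a = (\<Sum>C \<in> units G // orbit_rel G. \<tau>' C a)))))"
proof (intro conjI ballI allI impI)
  fix C x k \<tau>
  assume "C \<in> units G // orbit_rel G" "x \<in> C" "connecting_arrows G C x k"
  then have "groupoid_component G C x k"
    using assms(1) by (simp add: groupoid_component_def groupoid_component_axioms_def)
  moreover assume "tracial (group_cstar (isotropy_group G x)) \<tau>"
  ultimately show "\<exists>\<tau>'. induced_trace G C x k \<tau> \<tau>'"
    by (rule groupoid_component.induced_trace_exists[OF _ assms(2)])
next
  fix b k \<sigma>
  assume bk: "\<forall>C \<in> units G // orbit_rel G. b C \<in> C \<and> connecting_arrows G C (b C) (k C)"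
    and \<sigma>: "tracial (groupoid_cstar G) \<sigma>"
  \<comment> \<open>The summands are the cut-downs of \<open>\<sigma>\<close> by the class
    projections; the traces on the isotropy groups are then chosen class by class.\<close>
  let ?\<tau>' = "\<lambda>C a. \<sigma> (env_embed (groupoid_algebra G) (indicator C) \<otimes>\<^bsub>groupoid_cstar G\<^esub> a)"
  have "\<forall>C \<in> units G // orbit_rel G. \<exists>\<tau>. tracial (group_cstar (isotropy_group G (b C))) \<tau> \<and>
      induced_trace G C (b C) (k C) \<tau> (?\<tau>' C)"
  proof
    fix C assume "C \<in> units G // orbit_rel G"
    then have "groupoid_component G C (b C) (k C)"
      using assms(1) bk by (simp add: groupoid_component_def groupoid_component_axioms_def)
    then show "\<exists>\<tau>. tracial (group_cstar (isotropy_group G (b C))) \<tau> \<and>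
        induced_trace G C (b C) (k C) \<tau> (?\<tau>' C)"
      by (rule groupoid_component.induced_trace_component[OF _ assms(2) \<sigma>])
  qed
  then obtain \<tau> where "\<forall>C \<in> units G // orbit_rel G.
      tracial (group_cstar (isotropy_group G (b C))) (\<tau> C) \<and>
      induced_trace G C (b C) (k C) (\<tau> C) (?\<tau>' C)" by metis
  moreover have "\<forall>a\<in>carrier (groupoid_cstar G). \<sigma> a = (\<Sum>C \<in> units G // orbit_rel G. ?\<tau>' C a)"
    using groupoid.tracial_sum_components[OF assms \<sigma>] by blast
  ultimately show "\<exists>\<tau> \<tau>'.
      (\<forall>C \<in> units G // orbit_rel G.
         tracial (group_cstar (isotropy_group G (b C))) (\<tau> C) \<and>
         induced_trace G C (b C) (k C) (\<tau> C) (\<tau>' C)) \<and>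
      (\<forall>a \<in> carrier (groupoid_cstar G). \<sigma> a = (\<Sum>C \<in> units G // orbit_rel G. \<tau>' C a))"
    by (intro exI[of _ \<tau>] exI[of _ ?\<tau>']) blast
qed

end
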